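(* Let $\mathbf{k}$ be a field, and let $X$ and $\Omega$ be totally ordered sets. With the notation fixed in the context: (1) The linear map $\eta:\mathbf{k}\,\mathrm{MNE}_{\mathrm{NC},\Omega}(X)\to \mathrm{Nov}_{\mathrm{NC},\Omega}(X)$, $u\mapsto u+J$ (for $u\in \mathrm{MNE}_{\mathrm{NC},\Omega}(X)$), is bijective. (2) The cosets modulo $J$ of the noncommuting multi-Novikov elements in $\mathrm{MNE}_{\mathrm{NC},\Omega}(X)$ form a linear basis of the free noncommuting multi-Novikov algebra $\mathrm{Nov}_{\mathrm{NC},\Omega}(X)$. (3) The noncommuting multi-Novikov algebra homomorphism $\bar f:\mathrm{Nov}_{\mathrm{NC},\Omega}(X)\to \mathrm{PCD}_{\mathrm{NC},\Omega}(X)$ determined by $r(x)+J\mapsto x$ for $x\in X$ is an isomorphism. (4) The space $\mathrm{PCD}_{\mathrm{NC},\Omega}(X)$, together with the operations $u\ast_\omega v=u\,D_\omega(v)$, $\omega\in\Omega$, is a free noncommuting multi-Novikov algebra on $X$.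
   Context: **Noncommuting multi-Novikov algebras.** A noncommuting multi-Novikov algebra (indexed by $\Omega$) is a $\mathbf{k}$-vector space $N$ with bilinear products $\rhd_\omega$, $\omega\in\Omega$, such that for all $x,y,z\in N$, $\omega,\tau\in\Omega$: $(x\rhd_\omega y)\rhd_\tau z-x\rhd_\omega(y\rhd_\tau z)=(y\rhd_\omega x)\rhd_\tau z-y\rhd_\omega(x\rhd_\tau z)$ and $(x\rhd_\omega y)\rhd_\tau z=(x\rhd_\tau z)\rhd_\omega y$. Homomorphisms are linear maps preserving all $\rhd_\omega$; "free on $X$" means the usual universal property with respect to set maps from $X$. **Trees and $\mathrm{Nov}_{\mathrm{NC},\Omega}(X)$.** $\mathrm{MT}_\Omega(X)$ is the set of typed decorated rooted trees (vertices decorated by $X$, edges by $\Omega$), encoded as $r$-expressions, defined recursively: $r(z)$ for $z\in X$ (a single vertex; identified with $z$, so $X\subset \mathrm{MT}_\Omega(X)$; this is the case $n=0$ below), and $r(y_1,\omega_1,\dots,y_n,\omega_n;z)$ for $n\ge 1$, $z\in X$ (the root), $\omega_i\in\Omega$, $y_i\in\mathrm{MT}_\Omega(X)$ (the ordered branches, $y_i$ being attached to the root by an edge decorated by $\omega_i$). The space $\mathbf{k}\mathrm{MT}_\Omega(X)$ with basis $\mathrm{MT}_\Omega(X)$ has bilinear products $\rhd_\omega$ given by $u\rhd_\omega r(y_1,\omega_1,\dots,y_n,\omega_n;z)=r(u,\omega,y_1,\omega_1,\dots,y_n,\omega_n;z)$ and $u\rhd_\omega r(z)=r(u,\omega;z)$.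 $J$ is the two-sided ideal of $(\mathbf{k}\mathrm{MT}_\Omega(X),\{\rhd_\omega\}_{\omega\in\Omega})$ (subspace stable under left and right multiplication by all elements via all $\rhd_\omega$) generated by all elements $(x\rhd_\omega y)\rhd_\tau z-x\rhd_\omega(y\rhd_\tau z)-(y\rhd_\omega x)\rhd_\tau z+y\rhd_\omega(x\rhd_\tau z)$ and $(x\rhd_\omega y)\rhd_\tau z-(x\rhd_\tau z)\rhd_\omega y$, with $x,y,z\in\mathbf{k}\mathrm{MT}_\Omega(X)$, $\omega,\tau\in\Omega$. Put $\mathrm{Nov}_{\mathrm{NC},\Omega}(X):=\mathbf{k}\mathrm{MT}_\Omega(X)/J$ with the induced products; it is the free noncommuting multi-Novikov algebra on $X$ via $x\mapsto r(x)+J$. **Noncommuting multi-Novikov elements.** An $r$-expression $u$ is a *nest* if $u\in X$, or $u=r(y_1,\omega_1,\dots,y_n,\omega_n;z)$ with $n\ge1$, $y_i\in X$ for $i\ge2$ and $y_1$ itself a nest. A nest $u=r(y_1,\omega_1,\dots,y_n,\omega_n;z)$ is called *ordered* if it satisfies one of the following conditions: (i) $n=0$, in which case $u\in X$; (ii) $n>0$ and $y_1\in X$; (iii) $n>0$, $y_1=r(y_1',\omega_1',\dots,y_m',\omega_m';z')$ and $m>n$; (iv) $n>0$, $y_1=r(y_1',\omega_1',\dots,y_m',\omega_m';z')$, $m=n$ and $z'>z$; (v) $n>0$, $y_1=r(y_1',\omega_1',\dots,y_m',\omega_m';z')$, $m=n$, $z'=z$ and $(\omega_1',\dots,\omega_n')\ge(\omega_1,\dots,\omega_n)$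 in the lexicographical order. The left-to-right leaf sequence $L(u)$ of a nest is: $L(z)=(z)$ for $z\in X$, and $L(r(y_1,\omega_1,\dots,y_n,\omega_n;z))$ is $L(y_1)$ followed by $y_2,\dots,y_n$. A *noncommuting multi-Novikov element* is an ordered nest $u$ whose leaf sequence, read from right to left, is (weakly) increasing in $X$. $\mathrm{MNE}_{\mathrm{NC},\Omega}(X)$ is the set of these; $\mathbf{k}\,\mathrm{MNE}_{\mathrm{NC},\Omega}(X)\subseteq\mathbf{k}\mathrm{MT}_\Omega(X)$ is its span. **Differential polynomials and $\mathrm{PCD}_{\mathrm{NC},\Omega}(X)$.** $\mathbf{k}_{\mathrm{NC},\Omega}\{X\}$ is the commutative polynomial algebra over $\mathbf{k}$ in the variables $(\partial_{\omega_1}\cdots\partial_{\omega_k})(x)$ indexed by pairs consisting of a word $\partial_{\omega_1}\cdots\partial_{\omega_k}$ ($k\ge0$, $\omega_i\in\Omega$) in the free (noncommutative) monoid on symbols $\partial_\omega$, and $x\in X$ (the empty word gives the variable $x$). For $\omega\in\Omega$, $D_\omega$ is the derivation with $D_\omega((\partial_{\omega_1}\cdots\partial_{\omega_k})(x))=(\partial_\omega\partial_{\omega_1}\cdots\partial_{\omega_k})(x)$. With $u\ast_\omega v:=u\,D_\omega(v)$, $\mathbf{k}_{\mathrm{NC},\Omega}\{X\}$ is a noncommuting multi-Novikov algebra; $\mathrm{PCD}_{\mathrm{NC},\Omega}(X)$ is its noncommuting multi-Novikov subalgebra generated by $X$.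
   Formalization: "Ordered" is required at every level of the nest (y_1 must itself be ordered), since with (i)–(v) imposed only at the root distinct elements such as r(r(r(x,ω;z1),ω;z2),ω;z1) and r(r(r(x,ω;z2),ω;z1),ω;z1), z1<z2, agree modulo J; X and Ω are taken nonempty. *)

theory Defs
  imports Complex_Main "HOL-Library.Poly_Mapping"
begin

section \<open>Noncommuting multi-Novikov algebras\<close>

locale nc_multi_novikov = vector_space scale
  for scale :: "'k::field \<Rightarrow> 'n::ab_group_add \<Rightarrow> 'n" +
  fixes tri :: "'o \<Rightarrow> 'n \<Rightarrow> 'n \<Rightarrow> 'n"
  assumes linear_right: "Vector_Spaces.linear scale scale (\<lambda>y. tri w x y)"
    and linear_left: "Vector_Spaces.linear scale scale (\<lambda>x. tri w x y)"
    and left_symmetric: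
      "tri t (tri w x y) z - tri w x (tri t y z) = tri t (tri w y x) z - tri w y (tri t x z)"
    and right_commutative:
      "tri t (tri w x y) z = tri w (tri t x z) y"

definition nmn_hom ::
  "('k::field \<Rightarrow> 'a::ab_group_add \<Rightarrow> 'a) \<Rightarrow> ('o \<Rightarrow> 'a \<Rightarrow> 'a \<Rightarrow> 'a) \<Rightarrow>
   ('k \<Rightarrow> 'b::ab_group_add \<Rightarrow> 'b) \<Rightarrow> ('o \<Rightarrow> 'b \<Rightarrow> 'b \<Rightarrow> 'b) \<Rightarrow> ('a \<Rightarrow> 'b) \<Rightarrow> bool" where
  "nmn_hom scale1 tri1 scale2 tri2 h \<longleftrightarrow>
     Vector_Spaces.linear scale1 scale2 h \<and>
     (\<forall>w x y. h (tri1 w x y) = tri2 w (h x) (h y))"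

definition nmn_iso ::
  "('k::field \<Rightarrow> 'a::ab_group_add \<Rightarrow> 'a) \<Rightarrow> ('o \<Rightarrow> 'a \<Rightarrow> 'a \<Rightarrow> 'a) \<Rightarrow>
   ('k \<Rightarrow> 'b::ab_group_add \<Rightarrow> 'b) \<Rightarrow> ('o \<Rightarrow> 'b \<Rightarrow> 'b \<Rightarrow> 'b) \<Rightarrow> ('a \<Rightarrow> 'b) \<Rightarrow> bool" where
  "nmn_iso scale1 tri1 scale2 tri2 h \<longleftrightarrow> nmn_hom scale1 tri1 scale2 tri2 h \<and> bij h"

text \<open>
  The universal property with respect to all target algebras whose underlying type is \<open>'m\<close>.
  HOL cannot quantify over types inside a formula; a theorem that is polymorphic in \<open>'m\<close>
  expresses freeness with respect to all targets.
\<close>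

definition free_nc_multi_novikov ::
  "'m::ab_group_add itself \<Rightarrow> ('k::field \<Rightarrow> 'n::ab_group_add \<Rightarrow> 'n) \<Rightarrow>
   ('o \<Rightarrow> 'n \<Rightarrow> 'n \<Rightarrow> 'n) \<Rightarrow> ('x \<Rightarrow> 'n) \<Rightarrow> bool" where
  "free_nc_multi_novikov _ scale tri i \<longleftrightarrow>
     nc_multi_novikov scale tri \<and>
     (\<forall>(scale' :: 'k \<Rightarrow> 'm \<Rightarrow> 'm) tri' (g :: 'x \<Rightarrow> 'm).
        nc_multi_novikov scale' tri' \<longrightarrow>
        (\<exists>!h. nmn_hom scale tri scale' tri' h \<and> (\<forall>x. h (i x) = g x)))"

definition two_sided_ideal ::
  "('k::field \<Rightarrow> 'n::ab_group_add \<Rightarrow> 'n) \<Rightarrow> ('o \<Rightarrow> 'n \<Rightarrow> 'n \<Rightarrow> 'n) \<Rightarrow> 'n set \<Rightarrow> bool" where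
  "two_sided_ideal scale tri I \<longleftrightarrow>
     module.subspace scale I \<and> (\<forall>w a. \<forall>b\<in>I. tri w a b \<in> I \<and> tri w b a \<in> I)"

definition subalgebra ::
  "('k::field \<Rightarrow> 'n::ab_group_add \<Rightarrow> 'n) \<Rightarrow> ('o \<Rightarrow> 'n \<Rightarrow> 'n \<Rightarrow> 'n) \<Rightarrow> 'n set \<Rightarrow> bool" where
  "subalgebra scale tri S \<longleftrightarrow>
     module.subspace scale S \<and> (\<forall>w. \<forall>a\<in>S. \<forall>b\<in>S. tri w a b \<in> S)"


section \<open>Vector spaces with a given basis\<close>

text \<open>The space with basis \<open>'a\<close> is the type of finitely supported functions \<open>'a \<Rightarrow>\<^sub>0 'k\<close>.\<close>

definition kscale :: "'k::field \<Rightarrow> ('a \<Rightarrow>\<^sub>0 'k) \<Rightarrow> ('a \<Rightarrow>\<^sub>0 'k)" where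
  "kscale c p = Poly_Mapping.map ((*) c) p"

abbreviation basis_elem :: "'a \<Rightarrow> ('a \<Rightarrow>\<^sub>0 'k::field)" where
  "basis_elem a \<equiv> Poly_Mapping.single a 1"

definition lin_ext :: "('a \<Rightarrow> ('b \<Rightarrow>\<^sub>0 'k::field)) \<Rightarrow> ('a \<Rightarrow>\<^sub>0 'k) \<Rightarrow> ('b \<Rightarrow>\<^sub>0 'k)" where
  "lin_ext g p = (\<Sum>a\<in>Poly_Mapping.keys p. kscale (Poly_Mapping.lookup p a) (g a))"

lemma lookup_kscale [simp]:
  "Poly_Mapping.lookup (kscale c p) a = c * Poly_Mapping.lookup p a"
  by (simp add: kscale_def map.rep_eq when_def)

lemma vector_space_kscale: "vector_space (kscale :: 'k::field \<Rightarrow> ('a \<Rightarrow>\<^sub>0 'k) \<Rightarrow> _)"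
  by unfold_locales (rule poly_mapping_eqI; simp add: lookup_add algebra_simps)+

interpretation kspace: vector_space "kscale :: 'k::field \<Rightarrow> ('a \<Rightarrow>\<^sub>0 'k) \<Rightarrow> ('a \<Rightarrow>\<^sub>0 'k)"
  by (rule vector_space_kscale)

lemma lin_ext_superset:
  assumes "finite A" "Poly_Mapping.keys p \<subseteq> A"
  shows "lin_ext g p = (\<Sum>a\<in>A. kscale (Poly_Mapping.lookup p a) (g a))"
  unfolding lin_ext_def
  by (rule sum.mono_neutral_left) (use assms in \<open>auto simp: in_keys_iff\<close>)

lemma lin_ext_add: "lin_ext g (p + q) = lin_ext g p + lin_ext g q"
proof -
  let ?A = "Poly_Mapping.keys p \<union> Poly_Mapping.keys q"
  have "lin_ext g (p + q) = (\<Sum>a\<in>?A. kscale (Poly_Mapping.lookup (p + q) a) (g a))"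
    by (rule lin_ext_superset) (use Poly_Mapping.keys_add[of p q] in auto)
  also have "\<dots> = lin_ext g p + lin_ext g q"
    by (simp add: lin_ext_superset[of ?A] lookup_add kspace.scale_left_distrib sum.distrib)
  finally show ?thesis .
qed

lemma lin_ext_scale: "lin_ext g (kscale c p) = kscale c (lin_ext g p)"
proof -
  have "lin_ext g (kscale c p) =
      (\<Sum>a\<in>Poly_Mapping.keys p. kscale (Poly_Mapping.lookup (kscale c p) a) (g a))"
    by (rule lin_ext_superset) (auto simp: in_keys_iff)
  then show ?thesis by (simp add: lin_ext_def kspace.scale_sum_right)
qed

lemma linear_lin_ext: "Vector_Spaces.linear kscale kscale (lin_ext g)"
  by unfold_locales (simp_all add: lin_ext_add lin_ext_scale)

lemma lin_ext_basis_elem [simp]: "lin_ext g (basis_elem a) = g a"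
  by (simp add: lin_ext_def)

lemma lin_ext_fun_add: "lin_ext (\<lambda>a. g a + h a) p = lin_ext g p + lin_ext h p"
  by (simp add: lin_ext_def kspace.scale_right_distrib sum.distrib)

lemma lin_ext_fun_scale: "lin_ext (\<lambda>a. kscale c (g a)) p = kscale c (lin_ext g p)"
  by (simp add: lin_ext_def kspace.scale_sum_right mult.commute)


section \<open>Typed decorated rooted trees\<close>

text \<open>
  \<open>r(y\<^sub>1, \<omega>\<^sub>1, \<dots>, y\<^sub>n, \<omega>\<^sub>n; z)\<close> is \<open>R [(y\<^sub>1, \<omega>\<^sub>1), \<dots>, (y\<^sub>n, \<omega>\<^sub>n)] z\<close>. The sets \<open>X\<close> and \<open>\<Omega>\<close> are the
  types \<open>'x\<close> and \<open>'o\<close>.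
\<close>

datatype ('x, 'o) mtree = R (branches: "(('x, 'o) mtree \<times> 'o) list") (root: 'x)

abbreviation vertex :: "'x \<Rightarrow> ('x, 'o) mtree" where
  "vertex z \<equiv> R [] z"

fun graft :: "'o \<Rightarrow> ('x, 'o) mtree \<Rightarrow> ('x, 'o) mtree \<Rightarrow> ('x, 'o) mtree" where
  "graft w u (R bs z) = R ((u, w) # bs) z"

definition tree_tri ::
  "'o \<Rightarrow> (('x, 'o) mtree \<Rightarrow>\<^sub>0 'k::field) \<Rightarrow> (('x, 'o) mtree \<Rightarrow>\<^sub>0 'k) \<Rightarrow> (('x, 'o) mtree \<Rightarrow>\<^sub>0 'k)"
  where
  "tree_tri w p q = lin_ext (\<lambda>u. lin_ext (\<lambda>v. basis_elem (graft w u v)) q) p"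

definition novikov_relators :: "(('x, 'o) mtree \<Rightarrow>\<^sub>0 'k::field) set" where
  "novikov_relators =
     {tree_tri t (tree_tri w x y) z - tree_tri w x (tree_tri t y z)
        - tree_tri t (tree_tri w y x) z + tree_tri w y (tree_tri t x z) | w t x y z. True} \<union>
     {tree_tri t (tree_tri w x y) z - tree_tri w (tree_tri t x z) y | w t x y z. True}"

definition J :: "(('x, 'o) mtree \<Rightarrow>\<^sub>0 'k::field) set" where
  "J = two_sided_ideal kscale tree_tri hull novikov_relators"

lemma linear_tree_tri_left: "Vector_Spaces.linear kscale kscale (\<lambda>p. tree_tri w p q)"
  unfolding tree_tri_def by (rule linear_lin_ext)

lemma linear_tree_tri_right: "Vector_Spaces.linear kscale kscale (\<lambda>q. tree_tri w p q)"
  by unfold_locales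
    (simp_all add: tree_tri_def lin_ext_add lin_ext_scale lin_ext_fun_add lin_ext_fun_scale)

lemma tree_tri_basis_elem [simp]:
  "tree_tri w (basis_elem u) (basis_elem v) = basis_elem (graft w u v)"
  by (simp add: tree_tri_def)

lemma two_sided_ideal_J:
  "two_sided_ideal kscale tree_tri (J :: (('a, 'b) mtree \<Rightarrow>\<^sub>0 'c::field) set)"
  unfolding J_def
proof (rule hull_in)
  fix T :: "(('a, 'b) mtree \<Rightarrow>\<^sub>0 'c) set set"
  assume T: "Ball T (two_sided_ideal kscale tree_tri)"
  then have "kspace.subspace (\<Inter>T)"
    by (intro kspace.subspace_Inter) (simp add: two_sided_ideal_def)
  with T show "two_sided_ideal kscale tree_tri (\<Inter>T)"
    by (simp add: two_sided_ideal_def)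
qed

lemma subspace_J: "kspace.subspace J"
  by (rule two_sided_ideal_J[unfolded two_sided_ideal_def, THEN conjunct1])

lemma J_tri:
  "p \<in> J \<Longrightarrow> tree_tri w q p \<in> J"
  "p \<in> J \<Longrightarrow> tree_tri w p q \<in> J"
  by (simp_all add: two_sided_ideal_J[unfolded two_sided_ideal_def, THEN conjunct2, rule_format])


section \<open>The quotient by \<open>J\<close>\<close>

definition cong_J :: "(('x, 'o) mtree \<Rightarrow>\<^sub>0 'k::field) \<Rightarrow> (('x, 'o) mtree \<Rightarrow>\<^sub>0 'k) \<Rightarrow> bool" where
  "cong_J p q \<longleftrightarrow> p - q \<in> J"

lemma cong_J_refl: "cong_J p p"
  by (simp add: cong_J_def kspace.subspace_0[OF subspace_J])

lemma cong_J_sym: "cong_J p q \<Longrightarrow> cong_J q p"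
  unfolding cong_J_def by (drule kspace.subspace_neg[OF subspace_J]) simp

lemma cong_J_trans: "cong_J p q \<Longrightarrow> cong_J q r \<Longrightarrow> cong_J p r"
  unfolding cong_J_def by (drule (1) kspace.subspace_add[OF subspace_J]) simp

lemma equivp_cong_J: "equivp cong_J"
  by (intro equivpI reflpI sympI transpI) (fact cong_J_refl cong_J_sym cong_J_trans)+

lifting_forget poly_mapping.lifting

quotient_type (overloaded) ('x, 'o, 'k) nov = "('x, 'o) mtree \<Rightarrow>\<^sub>0 'k::field" / cong_J
  by (rule equivp_cong_J)

lift_definition coset :: "(('x, 'o) mtree \<Rightarrow>\<^sub>0 'k::field) \<Rightarrow> ('x, 'o, 'k) nov" is "\<lambda>p. p" .

instantiation nov :: (type, type, field) ab_group_add
begin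

lift_definition zero_nov :: "('a, 'b, 'c) nov" is 0 .

lift_definition plus_nov :: "('a, 'b, 'c) nov \<Rightarrow> ('a, 'b, 'c) nov \<Rightarrow> ('a, 'b, 'c) nov" is "(+)"
  by (simp add: cong_J_def add_diff_add kspace.subspace_add[OF subspace_J])

lift_definition uminus_nov :: "('a, 'b, 'c) nov \<Rightarrow> ('a, 'b, 'c) nov" is uminus
  unfolding cong_J_def by (drule kspace.subspace_neg[OF subspace_J]) simp

lift_definition minus_nov :: "('a, 'b, 'c) nov \<Rightarrow> ('a, 'b, 'c) nov \<Rightarrow> ('a, 'b, 'c) nov" is "(-)"
  unfolding cong_J_def
  by (drule (1) kspace.subspace_diff[OF subspace_J]) (simp add: algebra_simps)

instance
proof
  fix a b c :: "('a, 'b, 'c) nov"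
  show "a + b + c = a + (b + c)"
    by transfer (simp add: add.assoc cong_J_refl)
  show "a + b = b + a"
    by transfer (simp add: add.commute cong_J_refl)
  show "0 + a = a"
    by transfer (simp add: cong_J_refl)
  show "- a + a = 0"
    by transfer (simp add: cong_J_refl)
  show "a - b = a + - b"
    by transfer (simp add: cong_J_refl)
qed

end

lift_definition nov_scale :: "'k::field \<Rightarrow> ('x, 'o, 'k) nov \<Rightarrow> ('x, 'o, 'k) nov" is kscale
  unfolding cong_J_def
  by (metis kspace.scale_right_diff_distrib kspace.subspace_scale[OF subspace_J])

lift_definition nov_tri ::
  "'o \<Rightarrow> ('x, 'o, 'k::field) nov \<Rightarrow> ('x, 'o, 'k) nov \<Rightarrow> ('x, 'o, 'k) nov" is tree_tri
proof -
  fix w :: 'o and p p' q q' :: "('x, 'o) mtree \<Rightarrow>\<^sub>0 'k"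
  assume "cong_J p p'" "cong_J q q'"
  then have "tree_tri w (p - p') q + tree_tri w p' (q - q') \<in> J"
    by (simp add: cong_J_def J_tri kspace.subspace_add[OF subspace_J])
  also have "tree_tri w (p - p') q + tree_tri w p' (q - q') = tree_tri w p q - tree_tri w p' q'"
    using module_hom.diff[OF linear_tree_tri_left[unfolded linear_iff_module_hom], of w p p' q]
      module_hom.diff[OF linear_tree_tri_right[unfolded linear_iff_module_hom], of w p' q q']
    by simp
  finally show "cong_J (tree_tri w p q) (tree_tri w p' q')"
    by (simp add: cong_J_def)
qed


section \<open>Noncommuting multi-Novikov elements\<close>

inductive nest :: "('x, 'o) mtree \<Rightarrow> bool" where
  "nest (vertex z)"
| "nest y1 \<Longrightarrow> (\<And>y w. (y, w) \<in> set bs \<Longrightarrow> \<exists>x. y = vertex x) \<Longrightarrow> nest (R ((y1, w1) # bs) z)"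

text \<open>
  The comparison of a nest with its first branch is imposed at every level, i.e. the first
  branch has to be ordered as well. If only the root level were compared, then for \<open>z\<^sub>1 < z\<^sub>2\<close>
  both \<open>r(r(r(x,\<omega>;z\<^sub>1),\<omega>;z\<^sub>2),\<omega>;z\<^sub>1)\<close> and \<open>r(r(r(x,\<omega>;z\<^sub>2),\<omega>;z\<^sub>1),\<omega>;z\<^sub>1)\<close> would be ordered, although
  right commutativity identifies them modulo \<open>J\<close>.
\<close>

inductive ordered_nest :: "('x::linorder, 'o::linorder) mtree \<Rightarrow> bool" where
  single: "ordered_nest (vertex z)"
| leaf: "nest u \<Longrightarrow> u = R ((y1, w1) # bs) z \<Longrightarrow> y1 = vertex x \<Longrightarrow> ordered_nest u"
| longer: "nest u \<Longrightarrow> u = R ((y1, w1) # bs) z \<Longrightarrow> y1 = R cs z' \<Longrightarrow> ordered_nest y1 \<Longrightarrow>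
    length cs > length (branches u) \<Longrightarrow> ordered_nest u"
| root: "nest u \<Longrightarrow> u = R ((y1, w1) # bs) z \<Longrightarrow> y1 = R cs z' \<Longrightarrow> ordered_nest y1 \<Longrightarrow>
    length cs = length (branches u) \<Longrightarrow> z' > z \<Longrightarrow> ordered_nest u"
| lex: "nest u \<Longrightarrow> u = R ((y1, w1) # bs) z \<Longrightarrow> y1 = R cs z' \<Longrightarrow> ordered_nest y1 \<Longrightarrow>
    length cs = length (branches u) \<Longrightarrow> z' = z \<Longrightarrow>
    lexordp_eq (map snd (branches u)) (map snd cs) \<Longrightarrow> ordered_nest u"

fun leaf_seq :: "('x, 'o) mtree \<Rightarrow> 'x list" where
  "leaf_seq (R [] z) = [z]"
| "leaf_seq (R ((y1, w1) # bs) z) = leaf_seq y1 @ map (\<lambda>(y, w). root y) bs"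

definition MNE :: "('x::linorder, 'o::linorder) mtree set" where
  "MNE = {u. ordered_nest u \<and> sorted (rev (leaf_seq u))}"

definition kMNE :: "(('x::linorder, 'o::linorder) mtree \<Rightarrow>\<^sub>0 'k::field) set" where
  "kMNE = module.span kscale (basis_elem ` MNE)"


section \<open>Differential polynomials\<close>

text \<open>
  The variable \<open>(\<partial>\<^sub>\<omega>\<^sub>1 \<dots> \<partial>\<^sub>\<omega>\<^sub>k)(x)\<close> is the pair of the list of the \<open>\<omega>\<^sub>i\<close> and \<open>x\<close>, a monomial is a finitely
  supported exponent function, and multiplication of polynomials is the convolution product
  of \<open>_ \<Rightarrow>\<^sub>0 _\<close>.
\<close>

type_synonym ('x, 'o, 'k) dpoly = "(('o list \<times> 'x) \<Rightarrow>\<^sub>0 nat) \<Rightarrow>\<^sub>0 'k"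

definition dvar :: "'o list \<Rightarrow> 'x \<Rightarrow> ('x, 'o, 'k::field) dpoly" where
  "dvar ws x = basis_elem (Poly_Mapping.single (ws, x) 1)"

definition deriv_monom :: "'o \<Rightarrow> (('o list \<times> 'x) \<Rightarrow>\<^sub>0 nat) \<Rightarrow> ('x, 'o, 'k::field) dpoly" where
  "deriv_monom w m =
     (\<Sum>(ws, x)\<in>Poly_Mapping.keys m.
        of_nat (Poly_Mapping.lookup m (ws, x)) *
          basis_elem (m - Poly_Mapping.single (ws, x) 1) * dvar (w # ws) x)"

definition D :: "'o \<Rightarrow> ('x, 'o, 'k::field) dpoly \<Rightarrow> ('x, 'o, 'k) dpoly" where
  "D w = lin_ext (deriv_monom w)"

definition dpoly_tri ::
  "'o \<Rightarrow> ('x, 'o, 'k::field) dpoly \<Rightarrow> ('x, 'o, 'k) dpoly \<Rightarrow> ('x, 'o, 'k) dpoly" where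
  "dpoly_tri w u v = u * D w v"

lemma linear_D: "Vector_Spaces.linear kscale kscale (D w)"
  unfolding D_def by (rule linear_lin_ext)

lemma D_dvar: "D w (dvar ws x) = dvar (w # ws) x"
  by (simp add: D_def dvar_def deriv_monom_def)

lemma deriv_monom_superset:
  assumes "finite A" "Poly_Mapping.keys m \<subseteq> A"
  shows "deriv_monom w m =
     (\<Sum>(ws, x)\<in>A. of_nat (Poly_Mapping.lookup m (ws, x)) *
          basis_elem (m - Poly_Mapping.single (ws, x) 1) * dvar (w # ws) x)"
  unfolding deriv_monom_def
  by (rule sum.mono_neutral_left) (use assms in \<open>auto simp: in_keys_iff\<close>)

lemma deriv_monom_add:
  "(deriv_monom w (m + n) :: ('x, 'o, 'k::field) dpoly) =
     basis_elem m * deriv_monom w n + basis_elem n * deriv_monom w m"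
proof -
  let ?A = "Poly_Mapping.keys m \<union> Poly_Mapping.keys n"
  let ?s = "\<lambda>v. Poly_Mapping.single v (1::nat)"
  let ?b = "basis_elem :: _ \<Rightarrow> ('x, 'o, 'k) dpoly"
  have shift: "of_nat (Poly_Mapping.lookup k v) * ?b (l + k - ?s v) =
      ?b l * (of_nat (Poly_Mapping.lookup k v) * ?b (k - ?s v))" for k l v
  proof (cases "Poly_Mapping.lookup k v = 0")
    case False
    have "l + k - ?s v = l + (k - ?s v)"
      by (rule poly_mapping_eqI) (use False in \<open>auto simp: lookup_add lookup_minus lookup_single when_def\<close>)
    moreover have "?b (l + (k - ?s v)) = ?b l * ?b (k - ?s v)"
      by (simp add: mult_single)
    ultimately show ?thesis
      by (simp only: mult.left_commute)
  qed simp
  have summand: "of_nat (Poly_Mapping.lookup (m + n) v) * ?b (m + n - ?s v) * d =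
      ?b m * (of_nat (Poly_Mapping.lookup n v) * ?b (n - ?s v) * d) +
      ?b n * (of_nat (Poly_Mapping.lookup m v) * ?b (m - ?s v) * d)" for v d
  proof -
    have "of_nat (Poly_Mapping.lookup (m + n) v) * ?b (m + n - ?s v) =
        of_nat (Poly_Mapping.lookup n v) * ?b (m + n - ?s v) +
        of_nat (Poly_Mapping.lookup m v) * ?b (n + m - ?s v)"
      by (simp only: lookup_add of_nat_add distrib_right add.commute)
    then show ?thesis
      by (simp only: shift distrib_right mult.assoc)
  qed
  have "Poly_Mapping.keys (m + n) \<subseteq> ?A" by (rule Poly_Mapping.keys_add)
  then show ?thesis
    by (simp add: deriv_monom_superset[of ?A] summand case_prod_unfold sum.distrib sum_distrib_left
        del: One_nat_def)
qed

lemma kscale_single: "kscale c (Poly_Mapping.single a d) = Poly_Mapping.single a (c * d)"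
  by (rule poly_mapping_eqI) (simp add: lookup_single when_def)

lemma poly_mapping_sum_singles:
  "(\<Sum>a\<in>Poly_Mapping.keys p. Poly_Mapping.single a (Poly_Mapping.lookup p a)) = p"
  by (rule poly_mapping_eqI)
    (simp add: lookup_sum lookup_single when_def sum.delta in_keys_iff)

lemma kspace_induct [case_names basis scale add]:
  fixes p :: "'a \<Rightarrow>\<^sub>0 'k::field"
  assumes "\<And>a. P (basis_elem a)" "\<And>c p. P p \<Longrightarrow> P (kscale c p)" "\<And>p q. P p \<Longrightarrow> P q \<Longrightarrow> P (p + q)"
  shows "P p"
proof -
  have single: "P (Poly_Mapping.single a c)" for a c
    using assms(2)[OF assms(1), of c a] by (simp add: kscale_single)
  then have "P 0"
    by (metis single_zero)
  then have "P (\<Sum>a\<in>A. Poly_Mapping.single a (Poly_Mapping.lookup p a))" for A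
    by (induction A rule: infinite_finite_induct) (simp_all add: assms(3) single)
  then show ?thesis
    using poly_mapping_sum_singles[of p] by metis
qed

lemma kscale_eq_mult: "kscale c p = Poly_Mapping.single 0 c * p"
  for p :: "'a::monoid_add \<Rightarrow>\<^sub>0 'k::field"
proof -
  have "Poly_Mapping.single 0 c * p =
      Poly_Mapping.single 0 c *
        (\<Sum>a\<in>Poly_Mapping.keys p. Poly_Mapping.single a (Poly_Mapping.lookup p a))"
    by (simp add: poly_mapping_sum_singles)
  also have "\<dots> = (\<Sum>a\<in>Poly_Mapping.keys p. kscale c (Poly_Mapping.single a (Poly_Mapping.lookup p a)))"
    by (simp add: sum_distrib_left mult_single kscale_single)
  also have "\<dots> = kscale c p"
    by (simp add: kspace.scale_sum_right[symmetric] poly_mapping_sum_singles)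
  finally show ?thesis by simp
qed

lemma kscale_mult_left: "kscale c p * q = kscale c (p * q)"
  for p q :: "'a::monoid_add \<Rightarrow>\<^sub>0 'k::field"
  by (simp add: kscale_eq_mult mult.assoc)

lemma kscale_mult_right: "p * kscale c q = kscale c (p * q)"
  for p q :: "'a::comm_monoid_add \<Rightarrow>\<^sub>0 'k::field"
  by (simp add: kscale_eq_mult mult.left_commute)

lemma D_mult: "D w (p * q) = D w p * q + p * D w q"
proof (induction p rule: kspace_induct)
  case (basis m)
  show ?case
  proof (induction q rule: kspace_induct)
    case (basis n)
    show ?case
      by (simp add: mult_single D_def deriv_monom_add mult.commute add.commute)
  next
    case (scale c q)
    then show ?case
      by (simp add: kscale_mult_right D_def lin_ext_scale kspace.scale_right_distrib)
  next
    case (add q q')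
    then show ?case by (simp add: distrib_left D_def lin_ext_add)
  qed
next
  case (scale c p)
  then show ?case
    by (simp add: kscale_mult_left D_def lin_ext_scale kspace.scale_right_distrib)
next
  case (add p p')
  then show ?case by (simp add: distrib_right D_def lin_ext_add)
qed

definition PCD_set :: "('x, 'o, 'k::field) dpoly set" where
  "PCD_set = subalgebra kscale dpoly_tri hull range (dvar [])"

lemma subalgebra_PCD_set:
  "subalgebra kscale dpoly_tri (PCD_set :: ('a, 'b, 'c::field) dpoly set)"
  unfolding PCD_set_def
proof (rule hull_in)
  fix T :: "('a, 'b, 'c) dpoly set set"
  assume T: "Ball T (subalgebra kscale dpoly_tri)"
  then have "kspace.subspace (\<Inter>T)"
    by (intro kspace.subspace_Inter) (simp add: subalgebra_def)
  with T show "subalgebra kscale dpoly_tri (\<Inter>T)"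
    by (simp add: subalgebra_def)
qed

lemma subspace_PCD_set: "kspace.subspace PCD_set"
  by (rule subalgebra_PCD_set[unfolded subalgebra_def, THEN conjunct1])

typedef (overloaded) ('x, 'o, 'k::field) pcd = "PCD_set :: ('x, 'o, 'k) dpoly set"
  by (rule exI[of _ 0]) (rule kspace.subspace_0[OF subspace_PCD_set])

setup_lifting type_definition_pcd

instantiation pcd :: (type, type, field) ab_group_add
begin

lift_definition zero_pcd :: "('a, 'b, 'c) pcd" is 0
  by (rule kspace.subspace_0[OF subspace_PCD_set])

lift_definition plus_pcd :: "('a, 'b, 'c) pcd \<Rightarrow> ('a, 'b, 'c) pcd \<Rightarrow> ('a, 'b, 'c) pcd" is "(+)"
  by (rule kspace.subspace_add[OF subspace_PCD_set])

lift_definition uminus_pcd :: "('a, 'b, 'c) pcd \<Rightarrow> ('a, 'b, 'c) pcd" is uminus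
  by (rule kspace.subspace_neg[OF subspace_PCD_set])

lift_definition minus_pcd :: "('a, 'b, 'c) pcd \<Rightarrow> ('a, 'b, 'c) pcd \<Rightarrow> ('a, 'b, 'c) pcd" is "(-)"
  by (rule kspace.subspace_diff[OF subspace_PCD_set])

instance
proof
  fix a b c :: "('a, 'b, 'c) pcd"
  show "a + b + c = a + (b + c)"
    by transfer (rule add.assoc)
  show "a + b = b + a"
    by transfer (rule add.commute)
  show "0 + a = a"
    by transfer simp
  show "- a + a = 0"
    by transfer simp
  show "a - b = a + - b"
    by transfer simp
qed

end

lift_definition pcd_scale :: "'k::field \<Rightarrow> ('x, 'o, 'k) pcd \<Rightarrow> ('x, 'o, 'k) pcd" is kscale
  by (rule kspace.subspace_scale[OF subspace_PCD_set])

lift_definition pcd_tri ::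
  "'o \<Rightarrow> ('x, 'o, 'k::field) pcd \<Rightarrow> ('x, 'o, 'k) pcd \<Rightarrow> ('x, 'o, 'k) pcd" is dpoly_tri
  by (rule subalgebra_PCD_set[unfolded subalgebra_def, THEN conjunct2, rule_format])

lift_definition pcd_var :: "'x \<Rightarrow> ('x, 'o, 'k::field) pcd" is "dvar []"
  unfolding PCD_set_def by (rule hull_inc) (rule rangeI)

end

theory Submission
  imports Defs "HOL-Library.Multiset" "HOL-Library.Product_Lexorder" "HOL-Library.List_Lexorder"
begin

text \<open>
  Spanning. In a noncommuting multi-Novikov algebra all right multiplications commute, so the
  levels of a nest can be permuted freely. Left symmetry lets two neighbouring leaves of a level
  be exchanged modulo nests with fewer leaves, and the innermost leaf can be brought next to any
  level. By induction on the number of leaves every nest is therefore a combination of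
  noncommuting multi-Novikov elements. The span of the nests is closed under the products: if
  \<open>v = (v'' \<rhd>\<^sub>\<tau> B) \<rhd>\<^sub>\<sigma> Z\<close>, then left symmetry and right commutativity give
  \<open>u \<rhd>\<^sub>\<omega> v = (v'' \<rhd>\<^sub>\<omega> (u \<rhd>\<^sub>\<tau> B)) \<rhd>\<^sub>\<sigma> Z + (u \<rhd>\<^sub>\<omega> (v'' \<rhd>\<^sub>\<sigma> Z)) \<rhd>\<^sub>\<tau> B - ((v'' \<rhd>\<^sub>\<sigma> Z) \<rhd>\<^sub>\<omega> u) \<rhd>\<^sub>\<tau> B\<close>,
  where the inner products involve fewer levels.

  Independence. In differential polynomials a nest evaluates to the product of its leaves and of
  the variables \<open>(\<partial>\<^sub>\<omega>\<^sub>1 \<dots> \<partial>\<^sub>\<omega>\<^sub>n)(z)\<close> of its levels, plus monomials with fewer underived variables.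
  Distinct noncommuting multi-Novikov elements have distinct leading monomials.
\<close>

section \<open>Nests in a multi-Novikov algebra\<close>

fun tree_eval :: "('o \<Rightarrow> 'n \<Rightarrow> 'n \<Rightarrow> 'n) \<Rightarrow> ('x \<Rightarrow> 'n) \<Rightarrow> ('x, 'o) mtree \<Rightarrow> 'n" where
  "tree_eval tri g (R [] z) = g z"
| "tree_eval tri g (R ((y, w) # bs) z) = tri w (tree_eval tri g y) (tree_eval tri g (R bs z))"

text \<open>
  A nest is encoded by its innermost leaf \<open>x\<close> and the list of its levels, root first: the vertex
  \<open>r(y\<^sub>1, \<omega>\<^sub>1, \<dots>, y\<^sub>n, \<omega>\<^sub>n; z)\<close> gives the level \<open>(\<omega>\<^sub>1, [(y\<^sub>2, \<omega>\<^sub>2), \<dots>, (y\<^sub>n, \<omega>\<^sub>n)], z)\<close>. Accordingly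
  \<open>nleaves\<close> does not count the innermost leaf.
\<close>

type_synonym ('x, 'o) level = "'o \<times> ('x \<times> 'o) list \<times> 'x"

definition nest_tree :: "('x, 'o) level list \<Rightarrow> 'x \<Rightarrow> ('x, 'o) mtree" where
  "nest_tree ls x =
     foldr (\<lambda>(w, bs, z) u. R ((u, w) # map (\<lambda>(y, w). (vertex y, w)) bs) z) ls (vertex x)"

definition nleaves :: "('x, 'o) level list \<Rightarrow> nat" where
  "nleaves ls = sum_list (map (\<lambda>(w, bs, z). length bs) ls)"

definition comb :: "('o \<Rightarrow> 'n \<Rightarrow> 'n \<Rightarrow> 'n) \<Rightarrow> ('x \<Rightarrow> 'n) \<Rightarrow> ('x \<times> 'o) list \<Rightarrow> 'x \<Rightarrow> 'n" where
  "comb tri g bs z = foldr (\<lambda>(y, w). tri w (g y)) bs (g z)"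

text \<open>A nest is a composition of right multiplications, by one \<open>comb\<close> per level,
  applied to its innermost leaf. The argument \<open>e\<close> is arbitrary, so that other elements
  can take the innermost position.\<close>

definition spine ::
    "('o \<Rightarrow> 'n \<Rightarrow> 'n \<Rightarrow> 'n) \<Rightarrow> ('x \<Rightarrow> 'n) \<Rightarrow> ('x, 'o) level list \<Rightarrow> 'n \<Rightarrow> 'n" where
  "spine tri g ls e = foldr (\<lambda>(w, bs, z) u. tri w u (comb tri g bs z)) ls e"

lemma nest_tree_simps [simp]:
  "nest_tree [] x = vertex x"
  "nest_tree ((w, bs, z) # ls) x = R ((nest_tree ls x, w) # map (\<lambda>(y, w). (vertex y, w)) bs) z"
  by (simp_all add: nest_tree_def)

lemma nleaves_simps [simp]:
  "nleaves [] = 0"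
  "nleaves ((w, bs, z) # ls) = length bs + nleaves ls"
  by (simp_all add: nleaves_def)

lemma comb_simps [simp]:
  "comb tri g [] z = g z"
  "comb tri g ((y, w) # bs) z = tri w (g y) (comb tri g bs z)"
  by (simp_all add: comb_def)

lemma spine_simps [simp]:
  "spine tri g [] e = e"
  "spine tri g ((w, bs, z) # ls) e = tri w (spine tri g ls e) (comb tri g bs z)"
  by (simp_all add: spine_def)

lemma tree_eval_comb: "tree_eval tri g (R (map (\<lambda>(y, w). (vertex y, w)) bs) z) = comb tri g bs z"
  by (induction bs) auto

lemma tree_eval_nest_tree: "tree_eval tri g (nest_tree ls x) = spine tri g ls (g x)"
  by (induction ls) (auto simp: tree_eval_comb)

lemma tree_eval_graft: "tree_eval tri g (graft w u v) = tri w (tree_eval tri g u) (tree_eval tri g v)"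
  by (cases v) simp

text \<open>\<open>tree_eval\<close> recurses by undoing a \<open>graft\<close>, so its induction
  rule serves here once the first two arguments are forgotten.\<close>

lemma graft_induct [case_names vertex graft]:
  assumes "\<And>z. P (vertex z)" "\<And>w u v. P u \<Longrightarrow> P v \<Longrightarrow> P (graft w u v)"
  shows "P u"
  by (rule tree_eval.induct[of "\<lambda>_ _. P"]) (metis assms graft.simps)+

text \<open>Bubble sort: the head of the first list is carried to its place in the second by
  neighbour exchanges. Restricting \<open>swap\<close> to rearrangements of \<open>xs\<close> keeps
  the length known where the rule is applied.\<close>

lemma mset_eq_swap_induct:
  assumes "mset xs = mset ys"
    and refl: "\<And>xs. P xs xs"
    and trans: "\<And>xs ys zs. P xs ys \<Longrightarrow> P ys zs \<Longrightarrow> P xs zs"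
    and swap: "\<And>us a b vs. mset (us @ a # b # vs) = mset xs \<Longrightarrow> P (us @ a # b # vs) (us @ b # a # vs)"
  shows "P xs ys"
  using assms
proof (induction xs arbitrary: ys P)
  case Nil
  then show ?case by simp
next
  case (Cons a xs)
  have "a \<in> set ys"
    using Cons.prems(1) by (metis list.set_intros(1) mset_eq_setD)
  then obtain us vs where ys: "ys = us @ a # vs"
    by (meson split_list)
  have "mset xs = mset (us @ vs)"
    using Cons.prems(1) ys by simp
  then have "P (a # xs) (a # us @ vs)"
  \<comment> \<open>The hypothesis is applied to the relation \<open>P\<close> with \<open>a\<close>
    put in front of both lists.\<close>
  proof (rule Cons.IH)
    fix us' c d vs' assume "mset (us' @ c # d # vs') = mset xs"
    then show "P (a # us' @ c # d # vs') (a # us' @ d # c # vs')"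
      using Cons.prems(4)[of "a # us'" c d vs'] by simp
  qed (use Cons.prems in blast)+
  moreover have "P (a # us @ vs) (us @ a # vs)" if "mset (a # us @ vs) = mset (a # xs)" for vs
    using that
  proof (induction us arbitrary: vs rule: rev_induct)
    case Nil
    then show ?case by (simp add: Cons.prems(2))
  next
    case (snoc u us)
    have "P (a # us @ u # vs) (us @ a # u # vs)"
      using snoc.IH[of "u # vs"] snoc.prems by simp
    moreover have "P (us @ a # u # vs) (us @ u # a # vs)"
      using snoc.prems by (intro Cons.prems(4)) simp
    ultimately show ?case
      using Cons.prems(3) by fastforce
  qed
  ultimately show ?case
    using Cons.prems(1,3) ys by fastforce
qed

context nc_multi_novikov
begin

lemma tri_linear_simps:
  "tri w (x + y) z = tri w x z + tri w y z" "tri w x (y + z) = tri w x y + tri w x z"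
  "tri w (scale c x) z = scale c (tri w x z)" "tri w x (scale c z) = scale c (tri w x z)"
  "tri w (x - y) z = tri w x z - tri w y z" "tri w x (y - z) = tri w x y - tri w x z"
  "tri w 0 z = 0" "tri w x 0 = 0"
proof -
  interpret l: Vector_Spaces.linear scale scale "\<lambda>x. tri w x z" for w z by (rule linear_left)
  interpret r: Vector_Spaces.linear scale scale "\<lambda>x. tri w z x" for w z by (rule linear_right)
  show
    "tri w (x + y) z = tri w x z + tri w y z" "tri w x (y + z) = tri w x y + tri w x z"
    "tri w (scale c x) z = scale c (tri w x z)" "tri w x (scale c z) = scale c (tri w x z)"
    "tri w (x - y) z = tri w x z - tri w y z" "tri w x (y - z) = tri w x y - tri w x z"
    "tri w 0 z = 0" "tri w x 0 = 0"
    by (rule l.add r.add l.scale r.scale l.diff r.diff l.zero r.zero)+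
qed

section \<open>Filtration of the span of the nests by leaf number\<close>

lemma tri_in_subspace:
  assumes "x \<in> span A" "y \<in> span B" "subspace C" "\<And>a b. a \<in> A \<Longrightarrow> b \<in> B \<Longrightarrow> tri w a b \<in> C"
  shows "tri w x y \<in> C"
proof -
  have *: "tri w a y \<in> C" if "a \<in> A" for a
    using \<open>y \<in> span B\<close>
    by (induction rule: span_induct_alt)
      (use assms that in \<open>auto simp: tri_linear_simps subspace_0 subspace_add subspace_scale\<close>)
  show ?thesis
    using \<open>x \<in> span A\<close>
    by (induction rule: span_induct_alt)
      (use assms * in \<open>auto simp: tri_linear_simps subspace_0 subspace_add subspace_scale\<close>)
qed

text \<open>The bound is strict, so \<open>nest_span g (nleaves ls)\<close> is the space of
  correction terms for a nest with levels \<open>ls\<close>.\<close>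

definition nest_span :: "('x \<Rightarrow> 'n) \<Rightarrow> nat \<Rightarrow> 'n set" where
  "nest_span g k = span {spine tri g ls (g x) | ls x. nleaves ls < k}"

lemma subspace_nest_span [simp]: "subspace (nest_span g k)"
  by (simp add: nest_span_def)

lemma spine_in_nest_span: "nleaves ls < k \<Longrightarrow> spine tri g ls (g x) \<in> nest_span g k"
  unfolding nest_span_def by (intro span_base) blast

lemma nest_span_mono: "j \<le> k \<Longrightarrow> nest_span g j \<subseteq> nest_span g k"
  unfolding nest_span_def by (intro span_mono) fastforce

lemma spine_in_nest_span_mono:
  "x \<in> nest_span g j \<Longrightarrow> spine tri g ls x \<in> nest_span g (j + nleaves ls)"
proof (induction ls)
  case (Cons l ls)
  obtain w bs z where l: "l = (w, bs, z)" by (cases l)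
  define A where "A j = {spine tri g ls (g x) | ls x. nleaves ls < j}" for j
  have "tri w (spine tri g ls x) (comb tri g bs z) \<in> nest_span g (j + nleaves ls + length bs)"
  proof (rule tri_in_subspace)
    show "spine tri g ls x \<in> span (A (j + nleaves ls))"
      using Cons by (simp add: nest_span_def A_def)
    show "comb tri g bs z \<in> span {comb tri g bs z}"
      by (simp add: span_base)
    fix a b
    assume "a \<in> A (j + nleaves ls)" "b \<in> {comb tri g bs z}"
    then obtain ls' x where "a = spine tri g ls' (g x)" "nleaves ls' < j + nleaves ls"
      by (auto simp: A_def)
    then show "tri w a b \<in> nest_span g (j + nleaves ls + length bs)"
      using spine_in_nest_span[of "(w, bs, z) # ls'" "j + nleaves ls + length bs" g x]
        \<open>b \<in> _\<close> by simp
  qed simp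
  then show ?case by (simp add: l ac_simps)
qed simp

lemma nest_span_step:
  "x \<in> nest_span g j \<Longrightarrow> tri w x (comb tri g bs z) \<in> nest_span g (j + length bs)"
  using spine_in_nest_span_mono[of x g j "[(w, bs, z)]"] by simp

text \<open>If the right factor has at most one level, grafting yields a nest at once, with at most
  one new leaf. Otherwise the inner products involve fewer levels in total. The \<open>2\<close> is
  made up of the new leaf and the strict bound of \<open>nest_span\<close>.\<close>

lemma tri_spine_spine:
  "tri w (spine tri g ls (g x)) (spine tri g ms (g y)) \<in> nest_span g (nleaves ls + nleaves ms + 2)"
proof (induction "length ls + length ms" arbitrary: w ls ms x y rule: less_induct)
  case less
  consider "ms = []" | s bs z where "ms = [(s, bs, z)]" | s bs z t cs v ns where "ms = (s, bs, z) # (t, cs, v) # ns"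
    by (metis prod_cases3 remdups_adj.cases)
  then show ?case
  proof cases
    case 1
    then show ?thesis
      using spine_in_nest_span[of "(w, [], y) # ls" "nleaves ls + 2" g x] by simp
  next
    case 2
    then show ?thesis
      using spine_in_nest_span[of "(w, (y, s) # bs, z) # ls" "nleaves ls + length bs + 2" g x] by simp
  next
    case 3
    let ?Z = "comb tri g bs z" and ?B = "comb tri g cs v"
    let ?u = "spine tri g ls (g x)" and ?v = "spine tri g ns (g y)"
    let ?N = "nest_span g (nleaves ls + nleaves ms + 2)"
    \<comment> \<open>Right commutativity exchanges the two outer levels of \<open>ms\<close>; left
      symmetry is applied to \<open>?u\<close>, \<open>tri s ?v ?Z\<close> and \<open>?B\<close>;
      right commutativity then moves \<open>?Z\<close> outwards again.\<close>
    have eq: "tri w ?u (spine tri g ms (g y)) =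
        tri s (tri w ?v (tri t ?u ?B)) ?Z + tri t (tri w ?u (tri s ?v ?Z)) ?B
          - tri t (tri w (tri s ?v ?Z) ?u) ?B"
      using left_symmetric[of t w ?u "tri s ?v ?Z" ?B]
        right_commutative[of s t ?v ?B ?Z] right_commutative[of w s ?v ?Z "tri t ?u ?B"]
      by (simp add: 3 algebra_simps)
    have "tri w ?v (tri t ?u ?B) \<in> nest_span g (nleaves ns + (length cs + nleaves ls) + 2)"
      using less[of ns "(t, cs, v) # ls" w y x] 3 by simp
    from nest_span_step[OF this, of s bs z] have 1: "tri s (tri w ?v (tri t ?u ?B)) ?Z \<in> ?N"
      by (simp add: 3 ac_simps)
    have "tri w ?u (tri s ?v ?Z) \<in> nest_span g (nleaves ls + (length bs + nleaves ns) + 2)"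
      using less[of ls "(s, bs, z) # ns" w x y] 3 by simp
    from nest_span_step[OF this, of t cs v] have 2: "tri t (tri w ?u (tri s ?v ?Z)) ?B \<in> ?N"
      by (simp add: 3 ac_simps)
    have "tri w (tri s ?v ?Z) ?u \<in> nest_span g ((length bs + nleaves ns) + nleaves ls + 2)"
      using less[of "(s, bs, z) # ns" ls w y x] 3 by simp
    from nest_span_step[OF this, of t cs v] have "tri t (tri w (tri s ?v ?Z) ?u) ?B \<in> ?N"
      by (simp add: 3 ac_simps)
    with 1 2 show ?thesis
      unfolding eq by (intro subspace_diff subspace_add) auto
  qed
qed

lemma tri_spine_nest_span:
  assumes "e \<in> nest_span g k"
  shows "tri w (spine tri g ls (g x)) e \<in> nest_span g (nleaves ls + k + 1)"
proof (rule tri_in_subspace)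
  show "spine tri g ls (g x) \<in> span {spine tri g ls (g x)}"
    by (simp add: span_base)
  show "e \<in> span {spine tri g ls (g x) | ls x. nleaves ls < k}"
    using assms by (simp add: nest_span_def)
  fix a b
  assume "a \<in> {spine tri g ls (g x)}" "b \<in> {spine tri g ls (g x) | ls x. nleaves ls < k}"
  then obtain ms y where "nleaves ms < k" "a = spine tri g ls (g x)" "b = spine tri g ms (g y)"
    by blast
  then show "tri w a b \<in> nest_span g (nleaves ls + k + 1)"
    using tri_spine_spine[of w g ls x ms y]
      nest_span_mono[of "nleaves ls + nleaves ms + 2" "nleaves ls + k + 1"] by auto
qed simp

text \<open>The edges stay in place. By left symmetry the difference consists of
  \<open>tri t (tri w (g a) (g b)) ?Z\<close> and the same term with \<open>a\<close> and
  \<open>b\<close> exchanged; there one of the two leaves has become the root of a level, so the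
  leaf count falls by one.\<close>

lemma comb_swap:
  "comb tri g (us @ (a, w) # (b, t) # bs) z - comb tri g (us @ (b, w) # (a, t) # bs) z
     \<in> nest_span g (length us + length bs + 1)"
proof (induction us)
  case Nil
  let ?Z = "comb tri g bs z"
  have "tri w (g a) (tri t (g b) ?Z) - tri w (g b) (tri t (g a) ?Z) =
      tri t (tri w (g a) (g b)) ?Z - tri t (tri w (g b) (g a)) ?Z"
    using left_symmetric[of t w "g a" "g b" ?Z] by (simp add: algebra_simps)
  also have "\<dots> \<in> nest_span g (length bs + 1)"
    using spine_in_nest_span[of "[(t, bs, z), (w, [], b)]" "length bs + 1" g a]
      spine_in_nest_span[of "[(t, bs, z), (w, [], a)]" "length bs + 1" g b]
    by (intro subspace_diff) auto
  finally show ?case by simp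
next
  case (Cons u us)
  obtain y s where u: "u = (y, s)" by (cases u)
  show ?case
    using tri_spine_nest_span[OF Cons, of s "[]" y]
    by (simp add: u tri_linear_simps)
qed

lemma tri_comb_diff:
  assumes "comb tri g bs z - comb tri g cs v \<in> nest_span g k"
  shows "tri w (spine tri g ls (g x)) (comb tri g bs z) - tri w (spine tri g ls (g x)) (comb tri g cs v)
     \<in> nest_span g (nleaves ls + k + 1)"
  using tri_spine_nest_span[OF assms] by (simp add: tri_linear_simps)

lemma spine_diff: "spine tri g ls (e - e') = spine tri g ls e - spine tri g ls e'"
  by (induction ls) (auto simp: tri_linear_simps)

text \<open>A right multiplication commutes with those of all levels, so it may be carried out
  first, directly on the innermost element.\<close>

lemma spine_tri: "tri w (spine tri g ls e) u = spine tri g ls (tri w e u)"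
  by (induction ls) (auto simp: right_commutative[of w])

lemma spine_mset_eq:
  assumes "mset ls = mset ms"
  shows "spine tri g ls = spine tri g ms"
proof -
  define F where "F = (\<lambda>(w, bs, z) u. tri w u (comb tri g bs z))"
  have "F l \<circ> F l' = F l' \<circ> F l" for l l'
    by (cases l; cases l') (auto simp: F_def fun_eq_iff intro: right_commutative)
  then have "fold F (rev ls) = fold F (rev ms)"
    by (intro fold_multiset_equiv) (simp_all add: assms)
  then show ?thesis
    by (simp add: fun_eq_iff spine_def foldr_conv_fold F_def)
qed

end

section \<open>Spanning by noncommuting multi-Novikov elements\<close>

text \<open>The part of a level that permuting leaves does not touch. A nest is determined by its
  shapes and its right-to-left leaves; \<open>fill\<close> inverts this decomposition.\<close>

fun shape :: "('x, 'o) level \<Rightarrow> 'o \<times> 'o list \<times> 'x" where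
  "shape (w, bs, z) = (w, map snd bs, z)"

definition slots :: "('o \<times> 'o list \<times> 'x) list \<Rightarrow> nat" where
  "slots ps = sum_list (map (\<lambda>(w, ws, z). length ws) ps)"

definition rleaves :: "('x, 'o) level list \<Rightarrow> 'x \<Rightarrow> 'x list" where
  "rleaves ls x = concat (map (\<lambda>(w, bs, z). rev (map fst bs)) ls) @ [x]"

text \<open>
  The leaves are distributed in the order of \<open>rleaves\<close>, i.e. from right to left and hence
  increasing for a noncommuting multi-Novikov element; the last one is left over as the innermost leaf.
\<close>

fun fill :: "('o \<times> 'o list \<times> 'x) list \<Rightarrow> 'x list \<Rightarrow> ('x, 'o) level list" where
  "fill [] xs = []"
| "fill ((w, ws, z) # ps) xs =
     (w, zip (rev (take (length ws) xs)) ws, z) # fill ps (drop (length ws) xs)"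

lemma slots_simps [simp]:
  "slots [] = 0"
  "slots ((w, ws, z) # ps) = length ws + slots ps"
  by (simp_all add: slots_def)

lemma rleaves_simps [simp]:
  "rleaves [] x = [x]"
  "rleaves ((w, bs, z) # ls) x = rev (map fst bs) @ rleaves ls x"
  by (simp_all add: rleaves_def)

lemma last_rleaves [simp]: "last (rleaves ls x) = x"
  by (simp add: rleaves_def)

lemma length_rleaves [simp]: "length (rleaves ls x) = Suc (nleaves ls)"
  by (induction ls) auto

lemma slots_shape [simp]: "slots (map shape ls) = nleaves ls"
  by (induction ls) auto

lemma fill_shape [simp]: "fill (map shape ls) (rleaves ls x) = ls"
proof (induction ls)
  case (Cons l ls)
  obtain w bs z where "l = (w, bs, z)" by (cases l)
  with Cons show ?case by (simp add: zip_map_fst_snd)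
qed simp

lemma shape_fill: "slots ps \<le> length xs \<Longrightarrow> map shape (fill ps xs) = ps"
  by (induction ps xs rule: fill.induct) auto

lemma nleaves_fill: "slots ps \<le> length xs \<Longrightarrow> nleaves (fill ps xs) = slots ps"
  by (metis shape_fill slots_shape)

lemma rleaves_fill: "length xs = Suc (slots ps) \<Longrightarrow> rleaves (fill ps xs) (last xs) = xs"
proof (induction ps xs rule: fill.induct)
  case (1 xs)
  then show ?case by (cases xs) auto
next
  case (2 w ws z ps xs)
  then have "last (drop (length ws) xs) = last xs"
    by (intro last_drop) simp
  with 2 show ?case by auto
qed

lemma fill_append: "slots ps \<le> length xs \<Longrightarrow> fill ps (xs @ ys) = fill ps xs"
  by (induction ps xs rule: fill.induct) auto

lemma leaf_seq_nest_tree: "leaf_seq (nest_tree ls x) = rev (rleaves ls x)"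
  by (induction ls) (auto simp: comp_def case_prod_unfold)

context nc_multi_novikov
begin

text \<open>Neighbour exchanges suffice, within one level or across the border of two; by left
  symmetry each costs only nests with fewer leaves. The entry of \<open>xs\<close> beyond the slots
  is the innermost leaf.\<close>

lemma spine_fill_mset_eq:
  assumes "length xs = Suc (slots ps)" "mset xs = mset ys"
  shows "spine tri g (fill ps xs) (g (last xs)) - spine tri g (fill ps ys) (g (last ys))
    \<in> nest_span g (slots ps)"
  using assms
proof (induction ps arbitrary: xs ys)
  case Nil
  then obtain x where "xs = [x]" by (cases xs) auto
  with Nil show ?case by (simp add: subspace_0)
next
  case (Cons p ps)
  obtain w ws z where p: "p = (w, ws, z)" by (cases p)
  define G where "G ps xs = spine tri g (fill ps xs) (g (last xs))" for ps xs
  let ?N = "nest_span g (length ws + slots ps)"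
  note IH = Cons.IH[folded G_def]
  \<comment> \<open>Rearrangements below the root level, seen through the right multiplication by
    that level.\<close>
  have step: "tri w (G ps cs) (comb tri g bs z) - tri w (G ps cs') (comb tri g bs z) \<in> ?N"
    if "length cs = Suc (slots ps)" "mset cs = mset cs'" "length bs = length ws" for cs cs' bs
    using nest_span_step[OF IH[OF that(1,2)], of w bs z] that(3)
    by (simp add: tri_linear_simps ac_simps)
  have "G (p # ps) xs - G (p # ps) ys \<in> ?N"
    using Cons.prems(2)
  proof (rule mset_eq_swap_induct)
    show "G (p # ps) xs - G (p # ps) xs \<in> ?N" for xs
      by (simp add: subspace_0)
    show "G (p # ps) xs - G (p # ps) zs \<in> ?N"
      if "G (p # ps) xs - G (p # ps) ys \<in> ?N" "G (p # ps) ys - G (p # ps) zs \<in> ?N" for xs ys zs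
      using subspace_add[OF subspace_nest_span that] by simp
  next
    fix us a b vs
    assume "mset (us @ a # b # vs) = mset xs"
    then have "length (us @ a # b # vs) = length xs"
      by (metis size_mset)
    with Cons.prems(1) have len: "length us + length vs + 1 = length ws + slots ps"
      by (simp add: p)
    have last: "last (drop (length ws) xs) = last xs" if "length xs = Suc (length ws + slots ps)" for xs :: "'a list"
      using that by (intro last_drop) simp
    have G: "G (p # ps) xs =
        tri w (G ps (drop (length ws) xs)) (comb tri g (zip (rev (take (length ws) xs)) ws) z)"
      if "length xs = Suc (length ws + slots ps)" for xs
      using that by (simp add: G_def p last)
    \<comment> \<open>The first \<open>length ws\<close> entries go to the root level: the exchanged
      leaves lie both below it, on either side of its border, or both on it.\<close>
    consider "length ws \<le> length us" | "length ws = Suc (length us)"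
      | "Suc (Suc (length us)) \<le> length ws" by linarith
    then show "G (p # ps) (us @ a # b # vs) - G (p # ps) (us @ b # a # vs) \<in> ?N"
    proof cases
      case 1
      then show ?thesis
        using len by (simp add: G step)
    next
      case 2
      then obtain t ts where ws: "ws = t # ts" by (cases ws) auto
      let ?bs = "\<lambda>a. (a, t) # zip (rev us) ts"
      \<comment> \<open>\<open>a\<close> and \<open>b\<close> belong to different levels: move \<open>b\<close> to the innermost position, commute the
        outer level inwards, and exchange the two leaves there.\<close>
      have vs: "length vs = slots ps" using len 2 by simp
      have G': "G (p # ps) (us @ a # b # vs) = tri w (G ps (b # vs)) (comb tri g (?bs a) z)" for a b
        using len 2 by (subst G) (simp_all add: ws)
      have G'': "tri w (G ps (vs @ [b])) (comb tri g (?bs a) z) =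
          spine tri g (fill ps vs) (tri w (g b) (comb tri g (?bs a) z))" for a b
        using vs by (simp add: G_def fill_append spine_tri)
      have "tri w (G ps (b # vs)) (comb tri g (?bs a) z) -
          tri w (G ps (vs @ [b])) (comb tri g (?bs a) z) \<in> ?N" for a b
        using vs 2 ws by (intro step) auto
      note 3 = this[of b a] this[of a b]
      have "tri w (g b) (comb tri g (?bs a) z) - tri w (g a) (comb tri g (?bs b) z)
          \<in> nest_span g (length ws)"
        using comb_swap[of g "[]" b w a t "zip (rev us) ts" z] 2 ws by simp
      then have "tri w (G ps (vs @ [b])) (comb tri g (?bs a) z) -
          tri w (G ps (vs @ [a])) (comb tri g (?bs b) z) \<in> ?N"
        unfolding G'' spine_diff[symmetric]
        using spine_in_nest_span_mono[of _ g "length ws" "fill ps vs"] vs by (simp add: nleaves_fill)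
      \<comment> \<open>The differences telescope over the versions with \<open>b\<close>, then
        \<open>a\<close>, innermost.\<close>
      from subspace_diff[OF subspace_nest_span subspace_add[OF subspace_nest_span 3(1) this] 3(2)]
      show ?thesis
        unfolding G' by simp
    next
      case 3
      \<comment> \<open>\<open>vs1\<close> is the part of \<open>vs\<close> on the root level. As
        leaves are filled in from right to left, \<open>vs1\<close> stands there reversed, to the
        left of \<open>b\<close> and \<open>a\<close>, whose edges \<open>t\<close> and
        \<open>s\<close> follow the first \<open>length vs1\<close> entries of
        \<open>ws\<close>.\<close>
      define vs1 where "vs1 = take (length ws - length us - 2) vs"
      define vs2 where "vs2 = drop (length ws - length us - 2) vs"
      have vs: "vs = vs1 @ vs2" by (simp add: vs1_def vs2_def)
      have l1: "length ws = length us + length vs1 + 2" and l2: "length vs2 = Suc (slots ps)"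
        using 3 len by (auto simp: vs1_def vs2_def)
      obtain ws1 t s ws2 where ws: "ws = ws1 @ t # s # ws2" and l3: "length ws1 = length vs1"
      proof -
        have "ws = take (length vs1) ws @ ws ! length vs1 # ws ! Suc (length vs1) # drop (length vs1 + 2) ws"
          using l1 by (simp add: Cons_nth_drop_Suc)
        then show ?thesis using l1 that[of "take (length vs1) ws"] by simp
      qed
      let ?bs = "\<lambda>a b. zip (rev vs1) ws1 @ (b, t) # (a, s) # zip (rev us) ws2"
      have G': "G (p # ps) (us @ a # b # vs) = tri w (G ps vs2) (comb tri g (?bs a b) z)" for a b
      proof -
        have "take (length ws) (us @ a # b # vs) = us @ a # b # vs1"
          "drop (length ws) (us @ a # b # vs) = vs2"
          using l1 by (simp_all add: vs)
        then show ?thesis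
          using len l3 by (subst G) (simp_all add: ws zip_append)
      qed
      have "slots ps \<le> length vs2" using l2 by simp
      then have nl: "nleaves (fill ps vs2) = slots ps" by (rule nleaves_fill)
      have "tri w (G ps vs2) (comb tri g (?bs a b) z) - tri w (G ps vs2) (comb tri g (?bs b a) z)
          \<in> nest_span g (slots ps + (length (zip (rev vs1) ws1) + length (zip (rev us) ws2) + 1) + 1)"
        unfolding G_def nl[symmetric] by (rule tri_comb_diff[OF comb_swap])
      then show ?thesis
        unfolding G' using l1 l3 by (simp add: ws ac_simps)
    qed
  qed
  then show ?case by (simp add: G_def p)
qed

end

section \<open>Ordered nests as sorted lists of levels\<close>

lemma nest_nest_tree: "nest (nest_tree ls x)"
proof (induction ls)
  case Nil
  then show ?case by (simp add: nest.intros)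
next
  case (Cons l ls)
  obtain w bs z where l: "l = (w, bs, z)" by (cases l)
  show ?case
    unfolding l nest_tree_simps by (rule nest.intros(2)) (use Cons in auto)
qed

lemma nest_imp_nest_tree:
  assumes "nest u"
  obtains ls x where "u = nest_tree ls x"
proof -
  from assms have "\<exists>ls x. u = nest_tree ls x"
  proof induction
    case (1 z)
    then show ?case by (metis nest_tree_simps(1))
  next
    case (2 y1 bs w1 z)
    from 2(3) obtain ls x where y1: "y1 = nest_tree ls x" by blast
    have "map (\<lambda>(y, w). (vertex y, w)) (map (\<lambda>(y, w). (root y, w)) bs) = bs"
      unfolding map_map by (rule map_idI) (use 2(2) in force)
    then have "R ((y1, w1) # bs) z = nest_tree ((w1, map (\<lambda>(y, w). (root y, w)) bs, z) # ls) x"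
      by (simp add: y1)
    then show ?case by blast
  qed
  then show thesis using that by blast
qed

text \<open>The lexicographic order of these triples expresses the rules \<open>longer\<close>,
  \<open>root\<close> and \<open>lex\<close> of \<open>ordered_nest\<close>. Since \<open>ws\<close>
  omits the edge \<open>w\<close> of the first branch, its length is one less than the number of
  branches, uniformly for all levels.\<close>

fun shape_key :: "'o \<times> 'o list \<times> 'x \<Rightarrow> nat \<times> 'x \<times> 'o list" where
  "shape_key (w, ws, z) = (length ws, z, w # ws)"

lemma inj_shape_key: "inj shape_key"
  by (auto simp: inj_def)

lemma lexordp_eq_iff_le: "lexordp_eq xs ys \<longleftrightarrow> xs \<le> (ys :: 'o::linorder list)"
  by (simp add: lexordp_eq_conv_lexord list_le_def list_less_def lexordp_conv_lexord disj_commute)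

lemma ordered_nest_Cons:
  "ordered_nest (nest_tree ((w, bs, z) # (w', bs', z') # ls) x) \<longleftrightarrow>
     ordered_nest (nest_tree ((w', bs', z') # ls) x) \<and>
     shape_key (w, map snd bs, z) \<le> shape_key (w', map snd bs', z')"
    (is "ordered_nest ?u \<longleftrightarrow> ordered_nest ?v \<and> ?le")
proof -
  have snds: "snd \<circ> (\<lambda>(y, w). (vertex y, w)) = snd"
    by auto
  show ?thesis
  proof
    assume "ordered_nest ?u"
    then show "ordered_nest ?v \<and> ?le"
      by cases (auto simp: snds lexordp_eq_iff_le[symmetric])
  next
    assume v: "ordered_nest ?v \<and> ?le"
    have u: "nest ?u" by (rule nest_nest_tree)
    from v have "length bs < length bs' \<or> length bs = length bs' \<and> z < z' \<or>
        length bs = length bs' \<and> z = z' \<and> w # map snd bs \<le> w' # map snd bs'"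
      by (cases "length bs < length bs'"; cases "z < z'") auto
    then consider "length bs < length bs'" | "length bs = length bs'" "z < z'"
      | "length bs = length bs'" "z = z'" "w # map snd bs \<le> w' # map snd bs'"
      by blast
    then show "ordered_nest ?u"
    proof cases
      case 1
      show ?thesis by (rule ordered_nest.longer[OF u nest_tree_simps(2) nest_tree_simps(2)]) (use v 1 in auto)
    next
      case 2
      show ?thesis by (rule ordered_nest.root[OF u nest_tree_simps(2) nest_tree_simps(2)]) (use v 2 in auto)
    next
      case 3
      show ?thesis by (rule ordered_nest.lex[OF u nest_tree_simps(2) nest_tree_simps(2)])
          (use v 3 in \<open>auto simp: snds lexordp_eq_iff_le[symmetric]\<close>)
    qed
  qed
qed

text \<open>Only neighbouring levels are compared, which in a linear order amounts to sortedness,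
  with the root level smallest. A nest with one level is ordered through the rule
  \<open>leaf\<close>.\<close>

lemma ordered_nest_iff_sorted:
  "ordered_nest (nest_tree ls x) \<longleftrightarrow> sorted (map shape_key (map shape ls))"
proof (induction ls rule: induct_list012)
  case 1
  then show ?case by (simp add: ordered_nest.single)
next
  case (2 l)
  obtain w bs z where l: "l = (w, bs, z)" by (cases l)
  have "ordered_nest (nest_tree [l] x)"
    unfolding l by (rule ordered_nest.leaf[OF nest_nest_tree nest_tree_simps(2) nest_tree_simps(1)])
  then show ?case by simp
next
  case (3 l l' ls)
  obtain w bs z w' bs' z' where l: "l = (w, bs, z)" "l' = (w', bs', z')" by (cases l; cases l')
  show ?case
    unfolding l ordered_nest_Cons 3(2)[unfolded l] by (simp del: shape_key.simps) (auto simp del: shape_key.simps)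
qed

lemma nest_tree_in_MNE_iff:
  "nest_tree ls x \<in> MNE \<longleftrightarrow> sorted (map shape_key (map shape ls)) \<and> sorted (rleaves ls x)"
  by (simp add: MNE_def ordered_nest_iff_sorted leaf_seq_nest_tree del: map_map)

lemma ordered_nest_imp_nest: "ordered_nest u \<Longrightarrow> nest u"
  by (cases rule: ordered_nest.cases) (auto intro: nest.intros)

lemma MNE_imp_nest_tree:
  assumes "u \<in> MNE"
  obtains ls x where "u = nest_tree ls x" "sorted (map shape_key (map shape ls))" "sorted (rleaves ls x)"
proof -
  from assms have "nest u" by (simp add: MNE_def ordered_nest_imp_nest)
  then obtain ls x where "u = nest_tree ls x" by (rule nest_imp_nest_tree)
  with assms that show thesis by (simp only: nest_tree_in_MNE_iff)
qed

section \<open>Reduction of nests and trees to noncommuting multi-Novikov elements\<close>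

lemma spine_in_span_MNE:
  fixes scale :: "'k::field \<Rightarrow> 'n::ab_group_add \<Rightarrow> 'n" and tri :: "'o::linorder \<Rightarrow> 'n \<Rightarrow> 'n \<Rightarrow> 'n"
    and g :: "'x::linorder \<Rightarrow> 'n"
  assumes "nc_multi_novikov scale tri"
  shows "spine tri g ls (g x) \<in> module.span scale (tree_eval tri g ` MNE)"
proof -
  interpret nc_multi_novikov scale tri by (rule assms)
  show ?thesis
  proof (induction "nleaves ls" arbitrary: ls x rule: less_induct)
    case less
    \<comment> \<open>The levels are sorted at no cost by right commutativity. Sorting the leaves
      afterwards keeps the shapes, so \<open>ls2\<close> satisfies both order conditions.\<close>
    define ls1 where "ls1 = sort_key (shape_key \<circ> shape) ls"
    define xs where "xs = rleaves ls1 x"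
    define ls2 where "ls2 = fill (map shape ls1) (sort xs)"
    define y where "y = last (sort xs)"
    have ls1: "mset ls1 = mset ls" by (simp add: ls1_def)
    then have nl1: "nleaves ls1 = nleaves ls"
      by (metis mset_map nleaves_def sum_mset_sum_list)
    have len: "length (sort xs) = Suc (slots (map shape ls1))"
      by (simp add: xs_def)
    have "map shape ls2 = map shape ls1" "rleaves ls2 y = sort xs"
      unfolding ls2_def y_def using len by (auto intro!: shape_fill rleaves_fill simp del: map_map slots_shape)
    moreover have "sorted (map shape_key (map shape ls1))"
      by (simp add: ls1_def)
    ultimately have "nest_tree ls2 y \<in> MNE"
      by (simp only: nest_tree_in_MNE_iff) simp
    then have "tree_eval tri g (nest_tree ls2 y) \<in> span (tree_eval tri g ` MNE)"
      by (intro span_base imageI)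
    then have 1: "spine tri g ls2 (g y) \<in> span (tree_eval tri g ` MNE)"
      by (simp only: tree_eval_nest_tree)
    have "spine tri g ls1 (g x) - spine tri g ls2 (g y) \<in> nest_span g (nleaves ls)"
      using spine_fill_mset_eq[of xs "map shape ls1" "sort xs" g] nl1
      by (simp add: xs_def ls2_def y_def)
    also have "nest_span g (nleaves ls) \<subseteq> span (tree_eval tri g ` MNE)"
      unfolding nest_span_def by (intro span_minimal) (use less in auto)
    finally have "spine tri g ls1 (g x) \<in> span (tree_eval tri g ` MNE)"
      using span_add[OF _ 1, of "spine tri g ls1 (g x) - spine tri g ls2 (g y)"] by simp
    then show ?case
      by (simp only: spine_mset_eq[OF ls1])
  qed
qed

text \<open>Every tree is built by grafting from vertices, and the span is closed under products
  because the product of two nests is again a combination of nests.\<close>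

lemma tree_eval_in_span_MNE:
  fixes scale :: "'k::field \<Rightarrow> 'n::ab_group_add \<Rightarrow> 'n" and tri :: "'o::linorder \<Rightarrow> 'n \<Rightarrow> 'n \<Rightarrow> 'n"
    and g :: "'x::linorder \<Rightarrow> 'n"
  assumes "nc_multi_novikov scale tri"
  shows "tree_eval tri g u \<in> module.span scale (tree_eval tri g ` MNE)"
proof -
  interpret nc_multi_novikov scale tri by (rule assms)
  have MNE: "\<exists>ls x. a = spine tri g ls (g x)" if "a \<in> tree_eval tri g ` MNE" for a
  proof -
    from that obtain u where "u \<in> MNE" "a = tree_eval tri g u" by blast
    moreover from this(1) obtain ls x where "u = nest_tree ls x" by (rule MNE_imp_nest_tree)
    ultimately show ?thesis
      by (auto simp: tree_eval_nest_tree)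
  qed
  have nest_span: "nest_span g k \<subseteq> span (tree_eval tri g ` MNE)" for k
    unfolding nest_span_def by (intro span_minimal) (use spine_in_span_MNE[OF assms] in auto)
  show ?thesis
  proof (induction u rule: graft_induct)
    case (vertex z)
    then show ?case
      using spine_in_span_MNE[OF assms, of g "[]" z] by simp
  next
    case (graft w u v)
    then show ?case
      unfolding tree_eval_graft
    proof (rule tri_in_subspace)
      fix a b
      assume "a \<in> tree_eval tri g ` MNE" "b \<in> tree_eval tri g ` MNE"
      then obtain ls x ms y where "a = spine tri g ls (g x)" "b = spine tri g ms (g y)"
        using MNE by meson
      then show "tri w a b \<in> span (tree_eval tri g ` MNE)"
        using subsetD[OF nest_span tri_spine_spine] by simp
    qed simp
  qed
qed

section \<open>Leading monomials of nests\<close>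

text \<open>By the Leibniz rule both sides of left symmetry equal
  \<open>- x * y * D w (D t z)\<close>, with the derivations in the same order; right commutativity
  is commutativity of the product.\<close>

lemma dpoly_nc_multi_novikov:
  "nc_multi_novikov kscale (dpoly_tri :: 'o \<Rightarrow> ('x, 'o, 'k::field) dpoly \<Rightarrow> _)"
proof
  fix w t :: 'o and x y z :: "('x, 'o, 'k) dpoly" and c :: 'k
  show "dpoly_tri t (dpoly_tri w x y) z - dpoly_tri w x (dpoly_tri t y z) =
      dpoly_tri t (dpoly_tri w y x) z - dpoly_tri w y (dpoly_tri t x z)"
    by (simp add: dpoly_tri_def D_mult algebra_simps)
  show "dpoly_tri t (dpoly_tri w x y) z = dpoly_tri w (dpoly_tri t x z) y"
    by (simp add: dpoly_tri_def algebra_simps)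
qed (simp_all add: dpoly_tri_def D_def lin_ext_add lin_ext_scale kscale_mult_left kscale_mult_right
      algebra_simps)

section \<open>Degree in the underived variables\<close>

definition underived :: "(('o list \<times> 'x) \<Rightarrow>\<^sub>0 nat) \<Rightarrow> nat" where
  "underived m = (\<Sum>v\<in>Poly_Mapping.keys m. if fst v = [] then Poly_Mapping.lookup m v else 0)"

lemma underived_superset:
  assumes "finite A" "Poly_Mapping.keys m \<subseteq> A"
  shows "underived m = (\<Sum>v\<in>A. if fst v = [] then Poly_Mapping.lookup m v else 0)"
  unfolding underived_def
  by (rule sum.mono_neutral_left) (use assms in \<open>auto simp: in_keys_iff\<close>)

lemma underived_add: "underived (m + n) = underived m + underived n"
proof -
  let ?A = "Poly_Mapping.keys m \<union> Poly_Mapping.keys n"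
  have "underived (m + n) = (\<Sum>v\<in>?A. if fst v = [] then Poly_Mapping.lookup (m + n) v else 0)"
    by (rule underived_superset) (use Poly_Mapping.keys_add[of m n] in auto)
  also have "\<dots> = underived m + underived n"
    by (simp add: underived_superset[of ?A] flip: sum.distrib) (rule sum.cong; simp add: lookup_add)
  finally show ?thesis .
qed

lemma underived_zero [simp]: "underived 0 = 0"
  by (simp add: underived_def)

lemma underived_single [simp]:
  "underived (Poly_Mapping.single v n) = (if fst v = [] then n else 0)"
  by (simp add: underived_def)

text \<open>This filtration holds the non-leading part of a nest; its bound is strict as in
  \<open>nest_span\<close>.\<close>

definition lower :: "nat \<Rightarrow> ('x, 'o, 'k::field) dpoly set" where
  "lower k = {p. \<forall>m\<in>Poly_Mapping.keys p. underived m < k}"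

lemma subspace_lower: "kspace.subspace (lower k)"
proof (rule kspace.subspaceI)
  fix p q :: "('x, 'o, 'k::field) dpoly" and c :: 'k
  show "0 \<in> lower k" by (simp add: lower_def)
  show "p + q \<in> lower k" if "p \<in> lower k" "q \<in> lower k"
    using that Poly_Mapping.keys_add[of p q] by (auto simp: lower_def)
  show "kscale c p \<in> lower k" if "p \<in> lower k"
    using that by (auto simp: lower_def in_keys_iff)
qed

lemmas lower_add = kspace.subspace_add[OF subspace_lower]
  and lower_sum = kspace.subspace_sum[OF subspace_lower]
  and lower_scale = kspace.subspace_scale[OF subspace_lower]
  and lower_0 = kspace.subspace_0[OF subspace_lower]

lemma lower_mono: "p \<in> lower j \<Longrightarrow> j \<le> k \<Longrightarrow> p \<in> lower k"
  by (auto simp: lower_def)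

text \<open>Degrees add up. \<open>Suc i\<close> makes the bound on \<open>p\<close> weak, so that
  an error term stays strictly below when multiplied by a main term.\<close>

lemma lower_mult:
  assumes "p \<in> lower (Suc i)" "q \<in> lower k"
  shows "p * q \<in> lower (i + k)"
proof -
  have "underived (a + b) < i + k" if "a \<in> Poly_Mapping.keys p" "b \<in> Poly_Mapping.keys q" for a b
    using assms that unfolding lower_def underived_add by fastforce
  then show ?thesis
    unfolding lower_def using Poly_Mapping.keys_mult[of p q] by blast
qed

lemma basis_elem_in_lower: "underived m < k \<Longrightarrow> basis_elem m \<in> lower k"
  by (simp add: lower_def)

lemma of_nat_in_lower: "(of_nat n :: ('x, 'o, 'k::field) dpoly) \<in> lower 1"
proof (induction n)
  case (Suc n)
  have "(1 :: ('x, 'o, 'k) dpoly) \<in> lower 1"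
    using basis_elem_in_lower[of 0 1] by simp
  with Suc show ?case by (simp add: lower_add)
qed (simp add: lower_0)

lemma dvar_in_lower: "(if ws = [] then 1 else 0) < k \<Longrightarrow> dvar ws x \<in> lower k"
  unfolding dvar_def by (rule basis_elem_in_lower) (simp split: if_splits)

text \<open>A derivation replaces one variable of the monomial by a variable with nonempty word, so
  underived factors can only disappear.\<close>

lemma deriv_monom_in_lower: "deriv_monom w m \<in> lower (Suc (underived m))"
  unfolding deriv_monom_def
proof (rule lower_sum, clarify)
  fix ws x
  assume v: "(ws, x) \<in> Poly_Mapping.keys m"
  let ?s = "Poly_Mapping.single (ws, x) (1::nat)"
  have "m = (m - ?s) + ?s"
    by (rule poly_mapping_eqI) (use v in \<open>auto simp: lookup_add lookup_minus lookup_single when_def in_keys_iff\<close>)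
  then have "underived (m - ?s) \<le> underived m"
    by (metis underived_add le_add1)
  then have "basis_elem (m - ?s) \<in> lower (Suc (underived m))"
    by (intro basis_elem_in_lower) simp
  from lower_mult[OF of_nat_in_lower[unfolded One_nat_def] this, of "Poly_Mapping.lookup m (ws, x)"]
  have "of_nat (Poly_Mapping.lookup m (ws, x)) * basis_elem (m - ?s) \<in> lower (Suc (underived m))"
    by simp
  from lower_mult[OF this dvar_in_lower[of "w # ws" 1 x]]
  show "of_nat (Poly_Mapping.lookup m (ws, x)) * basis_elem (m - ?s) * dvar (w # ws) x
      \<in> lower (Suc (underived m))" by simp
qed

lemma D_in_lower: "p \<in> lower k \<Longrightarrow> D w p \<in> lower k"
  unfolding D_def lin_ext_def
  by (intro lower_sum lower_scale lower_mono[OF deriv_monom_in_lower]) (auto simp: lower_def Suc_le_eq)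

lemma D_add: "D w (p + q) = D w p + D w q"
  by (simp add: D_def lin_ext_add)

section \<open>Leading terms of nests\<close>

abbreviation leaf_prod :: "'x list \<Rightarrow> ('x, 'o, 'k::field) dpoly" where
  "leaf_prod xs \<equiv> prod_list (map (dvar []) xs)"

lemma leaf_prod_in_lower: "leaf_prod xs \<in> lower (Suc (length xs))"
proof (induction xs)
  case Nil
  then show ?case using of_nat_in_lower[of 1] by simp
next
  case (Cons x xs)
  then show ?case
    using lower_mult[OF dvar_in_lower[of "[]" "Suc 1" x] Cons] by simp
qed

text \<open>Here every factor is underived, and each Leibniz term turns one of them into a derived
  variable.\<close>

lemma D_leaf_prod_in_lower:
  "D w (leaf_prod xs :: ('x, 'o, 'k::field) dpoly) \<in> lower (length xs)"
proof (induction xs)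
  case Nil
  have "D w (1 * 1) = D w 1 * 1 + 1 * D w (1 :: ('x, 'o, 'k) dpoly)" by (rule D_mult)
  then show ?case by (simp add: lower_0)
next
  case (Cons x xs)
  have "dvar [w] x * (leaf_prod xs :: ('x, 'o, 'k) dpoly) \<in> lower (0 + Suc (length xs))"
    by (rule lower_mult[OF dvar_in_lower leaf_prod_in_lower]) simp
  moreover have "dvar [] x * D w (leaf_prod xs :: ('x, 'o, 'k) dpoly) \<in> lower (1 + length xs)"
    by (rule lower_mult[OF dvar_in_lower Cons]) simp
  ultimately show ?case
    by (simp add: D_mult D_dvar lower_add)
qed

text \<open>No leaf is lost only in the term where all derivations act on \<open>z\<close>, which
  collects the edge word there; any action on a leaf lowers the degree.\<close>

lemma D_comb:
  "D w (comb dpoly_tri (dvar []) bs z :: ('x, 'o, 'k::field) dpoly) - leaf_prod (map fst bs) * dvar (w # map snd bs) z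
     \<in> lower (length bs)"
proof (induction bs arbitrary: w)
  case Nil
  then show ?case by (simp add: D_dvar lower_0)
next
  case (Cons b bs)
  obtain y t where b: "b = (y, t)" by (cases b)
  let ?P = "leaf_prod (map fst bs) :: ('x, 'o, 'k) dpoly" and ?v = "dvar (t # map snd bs) z :: ('x, 'o, 'k) dpoly"
  define e :: "('x, 'o, 'k) dpoly" where "e = D t (comb dpoly_tri (dvar []) bs z) - ?P * ?v"
  have e: "e \<in> lower (length bs)" using Cons by (simp add: e_def)
  have c: "D t (comb dpoly_tri (dvar []) bs z) = ?P * ?v + e" by (simp add: e_def)
  \<comment> \<open>The remaining terms come from \<open>D w\<close> acting on the leaf
    \<open>y\<close>, on the other leaves and on the earlier error \<open>e\<close>; its action on
    \<open>?v\<close> gives the leading term.\<close>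
  have eq: "D w (comb dpoly_tri (dvar []) (b # bs) z) - leaf_prod (map fst (b # bs)) * dvar (w # map snd (b # bs)) z =
      dvar [w] y * (?P * ?v + e) + dvar [] y * (?v * D w ?P) + dvar [] y * D w e"
    by (simp add: b dpoly_tri_def c D_mult D_add D_dvar algebra_simps)
  have v: "?v \<in> lower (Suc 0)" by (rule dvar_in_lower) simp
  have "?v * ?P \<in> lower (Suc (length bs))"
    using lower_mult[OF v leaf_prod_in_lower, of "map fst bs"] by simp
  then have "?P * ?v + e \<in> lower (Suc (length bs))"
    using lower_mono[OF e, of "Suc (length bs)"] by (simp add: lower_add mult.commute)
  then have 1: "dvar [w] y * (?P * ?v + e) \<in> lower (0 + Suc (length bs))"
    by (intro lower_mult dvar_in_lower) simp_all
  have "?v * D w ?P \<in> lower (length bs)"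
    using lower_mult[OF v D_leaf_prod_in_lower, of w "map fst bs"] by simp
  then have 2: "dvar [] y * (?v * D w ?P) \<in> lower (1 + length bs)"
    by (intro lower_mult dvar_in_lower) simp_all
  have 3: "dvar [] y * D w e \<in> lower (1 + length bs)"
    using e by (intro lower_mult dvar_in_lower D_in_lower) simp_all
  from 1 2 3 show ?case
    unfolding eq by (simp add: lower_add)
qed

text \<open>The variables of the leading monomial, listed with multiplicity. Leaves have the empty
  word and levels a nonempty one, so the two kinds can be told apart.\<close>

fun nest_vars :: "('x, 'o) level list \<Rightarrow> 'x \<Rightarrow> ('o list \<times> 'x) list" where
  "nest_vars [] x = [([], x)]"
| "nest_vars ((w, bs, z) # ls) x = map (Pair []) (map fst bs) @ (w # map snd bs, z) # nest_vars ls x"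

abbreviation list_monom :: "'v list \<Rightarrow> 'v \<Rightarrow>\<^sub>0 nat" where
  "list_monom vs \<equiv> sum_list (map (\<lambda>v. Poly_Mapping.single v 1) vs)"

lemma lookup_list_monom: "Poly_Mapping.lookup (list_monom vs) v = count (mset vs) v"
  by (induction vs) (auto simp: lookup_add lookup_single)

lemma list_monom_eqD: "list_monom us = list_monom vs \<Longrightarrow> mset us = mset vs"
  by (rule multiset_eqI) (metis lookup_list_monom)

lemma prod_list_dvar: "prod_list (map (\<lambda>(ws, x). dvar ws x) vs) = basis_elem (list_monom vs)"
  by (induction vs) (auto simp: dvar_def mult_single)

lemma underived_nest_vars:
  "underived (list_monom (nest_vars ls x) :: ('o list \<times> 'x) \<Rightarrow>\<^sub>0 nat) = Suc (nleaves ls)"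
proof -
  have "underived (list_monom (map (Pair []) xs) :: ('o list \<times> 'x) \<Rightarrow>\<^sub>0 nat) = length xs" for xs
    by (induction xs) (auto simp: underived_add)
  then show ?thesis
    by (induction ls x rule: nest_vars.induct) (auto simp: underived_add simp del: map_map)
qed

lemma spine_dpoly_leading:
  "(spine dpoly_tri (dvar []) ls (dvar [] x) :: ('x, 'o, 'k::field) dpoly) -
     basis_elem (list_monom (nest_vars ls x)) \<in> lower (Suc (nleaves ls))"
proof (induction ls)
  case Nil
  then show ?case by (simp add: dvar_def lower_0)
next
  case (Cons l ls)
  obtain w bs z where l: "l = (w, bs, z)" by (cases l)
  let ?u = "spine dpoly_tri (dvar []) ls (dvar [] x)" and ?c = "D w (comb dpoly_tri (dvar []) bs z)"
  define M :: "('x, 'o, 'k) dpoly" where "M = basis_elem (list_monom (nest_vars ls x))"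
  define N :: "('x, 'o, 'k) dpoly" where "N = leaf_prod (map fst bs) * dvar (w # map snd bs) z"
  have "basis_elem (list_monom (nest_vars (l # ls) x)) = N * M"
    unfolding M_def N_def prod_list_dvar[symmetric] by (simp add: l comp_def mult.assoc)
  \<comment> \<open>With \<open>?u = M + (?u - M)\<close> and \<open>?c = N + (?c - N)\<close>,
    every product other than \<open>N * M\<close> contains an error factor.\<close>
  then have eq: "spine dpoly_tri (dvar []) (l # ls) (dvar [] x) - basis_elem (list_monom (nest_vars (l # ls) x)) =
      (?u - M) * (?c - N) + N * (?u - M) + M * (?c - N)"
    by (simp add: l dpoly_tri_def algebra_simps)
  have u: "?u - M \<in> lower (Suc (nleaves ls))"
    using Cons by (simp add: M_def)
  have c: "?c - N \<in> lower (length bs)"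
    unfolding N_def by (rule D_comb)
  have M: "M \<in> lower (Suc (Suc (nleaves ls)))"
    unfolding M_def by (rule basis_elem_in_lower) (simp add: underived_nest_vars del: One_nat_def)
  have "dvar (w # map snd bs) z * leaf_prod (map fst bs) \<in> lower (0 + Suc (length (map fst bs)))"
    by (intro lower_mult leaf_prod_in_lower dvar_in_lower) simp
  then have N: "N \<in> lower (Suc (length bs))"
    by (simp add: N_def mult.commute)
  show ?case
    unfolding eq using lower_mono[OF lower_mult[OF u c], of "Suc (nleaves (l # ls))"]
      lower_mult[OF N u] lower_mult[OF M c]
    by (simp add: l lower_add ac_simps)
qed

section \<open>Linear independence through leading monomials\<close>

lemma mset_nest_vars:
  "mset (nest_vars ls x) = image_mset (Pair []) (mset (rleaves ls x)) +
     image_mset (\<lambda>(w, ws, z). (w # ws, z)) (mset (map shape ls))"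
  by (induction ls) (auto simp: multiset.map_comp)

text \<open>The variables with empty and with nonempty word give the multisets of leaves and of
  shapes. For elements of \<open>MNE\<close> both lists are sorted, the shapes by an injective key,
  hence determined by their multisets.\<close>

lemma MNE_eq_if_nest_vars_eq:
  assumes "nest_tree ls x \<in> MNE" "nest_tree ms y \<in> MNE"
    and "mset (nest_vars ls x) = mset (nest_vars ms y)"
  shows "ls = ms \<and> x = y"
proof -
  have leaves: "mset (rleaves ls x) = image_mset snd (filter_mset (\<lambda>v. fst v = []) (mset (nest_vars ls x)))"
    for ls :: "('a, 'b) level list" and x
    unfolding mset_nest_vars by (auto simp: filter_mset_image_mset multiset.map_comp comp_def case_prod_unfold)
  have shapes: "mset (map shape ls) =
      image_mset (\<lambda>(ws, z). (hd ws, tl ws, z)) (filter_mset (\<lambda>v. fst v \<noteq> []) (mset (nest_vars ls x)))"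
    for ls :: "('a, 'b) level list" and x
    unfolding mset_nest_vars by (auto simp: filter_mset_image_mset multiset.map_comp comp_def case_prod_unfold)
  have "mset (rleaves ls x) = mset (rleaves ms y)"
    by (simp only: leaves assms(3))
  moreover have "sorted (rleaves ls x)" "sorted (rleaves ms y)"
    using assms(1,2) by (simp_all only: nest_tree_in_MNE_iff)
  ultimately have r: "rleaves ls x = rleaves ms y"
    using properties_for_sort[of "rleaves ls x" "rleaves ms y"] by (simp add: sorted_sort_id)
  have "mset (map shape ls) = mset (map shape ms)"
    by (simp only: shapes[of ls x] shapes[of ms y] assms(3))
  then have "mset (map shape_key (map shape ls)) = mset (map shape_key (map shape ms))"
    by (simp only: mset_map)
  moreover have "sorted (map shape_key (map shape ls))" "sorted (map shape_key (map shape ms))"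
    using assms(1,2) by (simp_all only: nest_tree_in_MNE_iff)
  ultimately have "map shape_key (map shape ls) = map shape_key (map shape ms)"
    using properties_for_sort[of "map shape_key (map shape ls)" "map shape_key (map shape ms)"]
    by (simp add: sorted_sort_id)
  then have "map shape ls = map shape ms"
    by (rule map_injective[OF _ inj_shape_key])
  then have "fill (map shape ls) (rleaves ls x) = fill (map shape ms) (rleaves ms y)"
    by (simp only: r)
  moreover have "last (rleaves ls x) = last (rleaves ms y)"
    by (simp only: r)
  ultimately show ?thesis by simp
qed

text \<open>A nest of maximal degree in the support of \<open>p\<close> contributes its leading
  monomial, which no other term can cancel.\<close>

lemma MNE_independent_dpoly:
  fixes p :: "('x::linorder, 'o::linorder) mtree \<Rightarrow>\<^sub>0 'k::field"
  assumes keys: "Poly_Mapping.keys p \<subseteq> MNE"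
    and zero: "lin_ext (tree_eval dpoly_tri (dvar [])) p = (0 :: ('x, 'o, 'k) dpoly)"
  shows "p = 0"
proof (rule ccontr)
  assume "p \<noteq> 0"
  let ?ev = "tree_eval dpoly_tri (dvar []) :: ('x, 'o) mtree \<Rightarrow> ('x, 'o, 'k) dpoly"
  have "\<forall>u\<in>MNE :: ('x, 'o) mtree set. \<exists>lx. u = nest_tree (fst lx) (snd lx)"
  proof
    fix u :: "('x, 'o) mtree" assume "u \<in> MNE"
    then obtain ls x where "u = nest_tree ls x" by (rule MNE_imp_nest_tree)
    then show "\<exists>lx. u = nest_tree (fst lx) (snd lx)" by (metis fst_conv snd_conv)
  qed
  from bchoice[OF this] obtain c
    where c: "\<And>u :: ('x, 'o) mtree. u \<in> MNE \<Longrightarrow> u = nest_tree (fst (c u)) (snd (c u))"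
    by blast
  \<comment> \<open>\<open>c\<close> chooses the levels and the innermost leaf of each nest; the
    leading monomial is read off from them.\<close>
  define lm where "lm u = list_monom (nest_vars (fst (c u)) (snd (c u)))" for u
  define deg where "deg u = underived (lm u)" for u
  have lm_inj: "u = v" if uv: "u \<in> MNE" "v \<in> MNE" and "lm u = lm v" for u v
  proof -
    have "mset (nest_vars (fst (c u)) (snd (c u))) = mset (nest_vars (fst (c v)) (snd (c v)))"
      using that(3) unfolding lm_def by (rule list_monom_eqD)
    moreover have "nest_tree (fst (c u)) (snd (c u)) \<in> MNE" "nest_tree (fst (c v)) (snd (c v)) \<in> MNE"
      using uv c by simp_all
    ultimately have "fst (c u) = fst (c v) \<and> snd (c u) = snd (c v)"
      by (intro MNE_eq_if_nest_vars_eq)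
    then have "nest_tree (fst (c u)) (snd (c u)) = nest_tree (fst (c v)) (snd (c v))"
      by simp
    then show ?thesis using c[OF uv(1)] c[OF uv(2)] by simp
  qed
  have lead: "?ev u - basis_elem (lm u) \<in> lower (deg u)" if "u \<in> MNE" for u
  proof -
    let ?ls = "fst (c u)" and ?x = "snd (c u)"
    have "?ev (nest_tree ?ls ?x) - basis_elem (lm u) \<in> lower (deg u)"
      unfolding tree_eval_nest_tree lm_def deg_def underived_nest_vars by (rule spine_dpoly_leading)
    then show ?thesis using c[OF that] by simp
  qed
  have "Poly_Mapping.keys p \<noteq> {}" using \<open>p \<noteq> 0\<close> by simp
  then have "Max (deg ` Poly_Mapping.keys p) \<in> deg ` Poly_Mapping.keys p"
    by (intro Max_in) simp_all
  then obtain u where u: "u \<in> Poly_Mapping.keys p" and "deg u = Max (deg ` Poly_Mapping.keys p)"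
    by force
  then have max: "deg v \<le> deg u" if "v \<in> Poly_Mapping.keys p" for v
    using that by simp
  have coeff: "Poly_Mapping.lookup (?ev v) (lm u) = (if v = u then 1 else 0)"
    if v: "v \<in> Poly_Mapping.keys p" for v
  proof -
    have MNE: "u \<in> MNE" "v \<in> MNE" using u v keys by auto
    \<comment> \<open>The error monomials of \<open>?ev v\<close> have degree below
      \<open>deg v\<close>, hence below \<open>deg u\<close>.\<close>
    have "lm u \<notin> Poly_Mapping.keys (?ev v - basis_elem (lm v))"
      using lead[OF MNE(2)] max[OF v] by (force simp: lower_def deg_def)
    then have "Poly_Mapping.lookup (?ev v) (lm u) = Poly_Mapping.lookup (basis_elem (lm v)) (lm u)"
      by (simp add: in_keys_iff lookup_minus)
    also have "\<dots> = (if v = u then 1 else 0)"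
      using lm_inj[OF MNE] by (auto simp: lookup_single when_def)
    finally show ?thesis .
  qed
  have "0 = Poly_Mapping.lookup (lin_ext ?ev p) (lm u)"
    using zero by simp
  also have "\<dots> = (\<Sum>v\<in>Poly_Mapping.keys p. Poly_Mapping.lookup p v * (if v = u then 1 else 0))"
    unfolding lin_ext_def lookup_sum lookup_kscale by (rule sum.cong) (simp_all add: coeff)
  also have "\<dots> = Poly_Mapping.lookup p u"
    using u by (simp add: sum.delta if_distrib cong: if_cong)
  finally show False
    using u by (simp add: in_keys_iff)
qed

lemma keys_span_basis_elem:
  "p \<in> kspace.span (basis_elem ` A) \<Longrightarrow> Poly_Mapping.keys (p :: 'a \<Rightarrow>\<^sub>0 'k::field) \<subseteq> A"
proof (induction rule: kspace.span_induct_alt)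
  case base
  then show ?case by simp
next
  case (step c x y)
  have "Poly_Mapping.keys (kscale c x) \<subseteq> Poly_Mapping.keys x"
    by (auto simp: in_keys_iff)
  with step show ?case
    using Poly_Mapping.keys_add[of "kscale c x" y] by fastforce
qed

lemma independent_basis_elem: "kspace.independent (basis_elem ` A :: ('a \<Rightarrow>\<^sub>0 'k::field) set)"
proof
  assume "kspace.dependent (basis_elem ` A :: ('a \<Rightarrow>\<^sub>0 'k::field) set)"
  then obtain a where "a \<in> A" "basis_elem a \<in> kspace.span (basis_elem ` A - {basis_elem a :: 'a \<Rightarrow>\<^sub>0 'k})"
    by (auto simp: kspace.dependent_def)
  moreover have "basis_elem ` A - {basis_elem a :: 'a \<Rightarrow>\<^sub>0 'k} \<subseteq> basis_elem ` (A - {a})"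
    by auto
  ultimately have "(basis_elem a :: 'a \<Rightarrow>\<^sub>0 'k) \<in> kspace.span (basis_elem ` (A - {a}))"
    using kspace.span_mono by blast
  from keys_span_basis_elem[OF this] show False by simp
qed

section \<open>Freeness of the quotient and the isomorphism\<close>

text \<open>Linear extension as in \<open>lin_ext\<close>, but into an arbitrary vector space, as
  the universal property requires.\<close>

definition lin_map :: "('k::field \<Rightarrow> 'm::ab_group_add \<Rightarrow> 'm) \<Rightarrow> ('a \<Rightarrow> 'm) \<Rightarrow> ('a \<Rightarrow>\<^sub>0 'k) \<Rightarrow> 'm" where
  "lin_map scale h p = (\<Sum>a\<in>Poly_Mapping.keys p. scale (Poly_Mapping.lookup p a) (h a))"

lemma lin_map_kscale: "lin_map kscale = lin_ext"
  by (simp add: fun_eq_iff lin_map_def lin_ext_def)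

lemma linear_lin_map:
  assumes "vector_space scale"
  shows "Vector_Spaces.linear kscale scale (lin_map scale h)"
proof -
  interpret vector_space scale by (rule assms)
  have superset: "lin_map scale h p = (\<Sum>a\<in>A. scale (Poly_Mapping.lookup p a) (h a))"
    if "finite A" "Poly_Mapping.keys p \<subseteq> A" for A p
    unfolding lin_map_def by (rule sum.mono_neutral_left) (use that in \<open>auto simp: in_keys_iff\<close>)
  have "lin_map scale h (p + q) = lin_map scale h p + lin_map scale h q" for p q
  proof -
    let ?A = "Poly_Mapping.keys p \<union> Poly_Mapping.keys q"
    have "lin_map scale h (p + q) = (\<Sum>a\<in>?A. scale (Poly_Mapping.lookup (p + q) a) (h a))"
      by (rule superset) (use Poly_Mapping.keys_add[of p q] in auto)
    then show ?thesis
      by (simp add: superset[of ?A] lookup_add scale_left_distrib sum.distrib)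
  qed
  moreover have "lin_map scale h (kscale c p) = scale c (lin_map scale h p)" for c p
  proof -
    have "lin_map scale h (kscale c p) =
        (\<Sum>a\<in>Poly_Mapping.keys p. scale (Poly_Mapping.lookup (kscale c p) a) (h a))"
      by (rule superset) (auto simp: in_keys_iff)
    then show ?thesis by (simp add: lin_map_def scale_sum_right)
  qed
  ultimately show ?thesis
    by (simp add: Vector_Spaces.linear_iff assms vector_space_kscale)
qed

lemma linear_eq_lin_map:
  assumes "Vector_Spaces.linear kscale scale H"
  shows "H p = lin_map scale (\<lambda>a. H (basis_elem a)) p"
proof -
  interpret Vector_Spaces.linear kscale scale H by (rule assms)
  have "H p = H (\<Sum>a\<in>Poly_Mapping.keys p. kscale (Poly_Mapping.lookup p a) (basis_elem a))"
    by (simp add: kscale_single poly_mapping_sum_singles)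
  then show ?thesis
    by (simp add: sum scale lin_map_def)
qed

section \<open>The quotient as a multi-Novikov algebra\<close>

lemma coset_simps:
  "coset 0 = 0" "coset (p + q) = coset p + coset q" "coset (p - q) = coset p - coset q"
  "coset (kscale c p) = nov_scale c (coset p)"
  "coset (tree_tri w p q) = nov_tri w (coset p) (coset q)"
  by (transfer, rule cong_J_refl)+

lemma coset_eq_iff: "coset p = coset q \<longleftrightarrow> p - q \<in> J"
  by transfer (simp add: cong_J_def)

lemma surj_coset: "surj coset"
proof (rule surjI)
  show "coset (rep_nov c) = c" for c
    by (metis Quotient3_abs_rep Quotient3_nov coset.abs_eq)
qed

lemma vector_space_nov: "vector_space (nov_scale :: 'k::field \<Rightarrow> ('x, 'o, 'k) nov \<Rightarrow> _)"
proof
  show "nov_scale a (x + y) = nov_scale a x + nov_scale a y" for a and x y :: "('x, 'o, 'k) nov"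
    by transfer (simp add: kspace.scale_right_distrib cong_J_refl)
  show "nov_scale (a + b) x = nov_scale a x + nov_scale b x" for a b and x :: "('x, 'o, 'k) nov"
    by transfer (simp add: kspace.scale_left_distrib cong_J_refl)
  show "nov_scale a (nov_scale b x) = nov_scale (a * b) x" for a b and x :: "('x, 'o, 'k) nov"
    by transfer (simp add: cong_J_refl)
  show "nov_scale 1 x = x" for x :: "('x, 'o, 'k) nov"
    by transfer (simp add: cong_J_refl)
qed

lemma linear_coset: "Vector_Spaces.linear kscale nov_scale coset"
  by (simp add: Vector_Spaces.linear_iff vector_space_kscale vector_space_nov coset_simps)

lemma nov_nc_multi_novikov: "nc_multi_novikov nov_scale (nov_tri :: 'o \<Rightarrow> ('x, 'o, 'k::field) nov \<Rightarrow> _)"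
proof -
  interpret vector_space "nov_scale :: 'k \<Rightarrow> ('x, 'o, 'k) nov \<Rightarrow> _" by (rule vector_space_nov)
  have cos: "\<exists>p. c = coset p" for c :: "('x, 'o, 'k) nov"
    using surj_coset by (metis surjD)
  note left = linear_tree_tri_left[unfolded Vector_Spaces.linear_iff, THEN conjunct2, THEN conjunct2]
  note right = linear_tree_tri_right[unfolded Vector_Spaces.linear_iff, THEN conjunct2, THEN conjunct2]
  show ?thesis
  proof unfold_locales
    fix w t :: 'o and a b c :: "('x, 'o, 'k) nov" and k :: 'k
    obtain x y z where xyz: "a = coset x" "b = coset y" "c = coset z"
      using cos by metis
    show "nov_tri w a (b + c) = nov_tri w a b + nov_tri w a c"
      "nov_tri w (a + b) c = nov_tri w a c + nov_tri w b c"
      "nov_tri w a (nov_scale k b) = nov_scale k (nov_tri w a b)"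
      "nov_tri w (nov_scale k a) b = nov_scale k (nov_tri w a b)"
      unfolding xyz coset_simps[symmetric] by (simp_all add: left right)
    have "tree_tri t (tree_tri w x y) z - tree_tri w x (tree_tri t y z)
        - tree_tri t (tree_tri w y x) z + tree_tri w y (tree_tri t x z) \<in> J"
      unfolding J_def novikov_relators_def by (rule hull_inc) blast
    then show "nov_tri t (nov_tri w a b) c - nov_tri w a (nov_tri t b c) =
        nov_tri t (nov_tri w b a) c - nov_tri w b (nov_tri t a c)"
      unfolding xyz coset_simps[symmetric] coset_eq_iff diff_diff_eq2 diff_add_eq .
    have "tree_tri t (tree_tri w x y) z - tree_tri w (tree_tri t x z) y \<in> J"
      unfolding J_def novikov_relators_def by (rule hull_inc) blast
    then show "nov_tri t (nov_tri w a b) c = nov_tri w (nov_tri t a c) b"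
      unfolding xyz coset_simps[symmetric] coset_eq_iff .
  qed
qed

lemma nmn_hom_tree_eval:
  assumes "nmn_hom scale1 tri1 scale2 tri2 h"
  shows "h (tree_eval tri1 g u) = tree_eval tri2 (\<lambda>x. h (g x)) u"
  using assms by (induction u rule: graft_induct) (simp_all add: tree_eval_graft nmn_hom_def)

lemma coset_basis_elem: "coset (basis_elem u) = tree_eval nov_tri (\<lambda>x. coset (basis_elem (vertex x))) u"
proof (induction u rule: graft_induct)
  case (graft w u v)
  then show ?case
    unfolding tree_tri_basis_elem[symmetric] coset_simps tree_eval_graft by simp
qed simp

text \<open>Every tree is an iterated product of vertices, so a homomorphism is forced on its coset;
  this is the uniqueness half of freeness.\<close>

lemma nmn_hom_coset:
  assumes "nmn_hom nov_scale nov_tri scale tri h" "\<And>x. h (coset (basis_elem (vertex x))) = g x"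
  shows "h (coset p) = lin_map scale (tree_eval tri g) p"
proof -
  have lin: "Vector_Spaces.linear kscale scale (h \<circ> coset)"
    using assms(1) linear_coset by (auto simp: nmn_hom_def Vector_Spaces.linear_iff)
  have "h (coset (basis_elem u)) = tree_eval tri g u" for u
    unfolding coset_basis_elem[of u] nmn_hom_tree_eval[OF assms(1)] assms(2) ..
  then show ?thesis
    using linear_eq_lin_map[OF lin, of p] by simp
qed

lemma lin_map_tree_tri:
  assumes "nc_multi_novikov scale tri"
  shows "lin_map scale (tree_eval tri g) (tree_tri w p q) =
    tri w (lin_map scale (tree_eval tri g) p) (lin_map scale (tree_eval tri g) q)"
    (is "?H (tree_tri w p q) = _")
proof -
  interpret nc_multi_novikov scale tri by (rule assms)
  interpret H: Vector_Spaces.linear kscale scale ?H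
    by (rule linear_lin_map) (rule vector_space_axioms)
  note left = linear_tree_tri_left[unfolded Vector_Spaces.linear_iff, THEN conjunct2, THEN conjunct2]
  note right = linear_tree_tri_right[unfolded Vector_Spaces.linear_iff, THEN conjunct2, THEN conjunct2]
  have basis: "?H (basis_elem u) = tree_eval tri g u" for u
    by (simp add: lin_map_def)
  show ?thesis
  proof (induction p rule: kspace_induct)
    case (basis u)
    show ?case
    proof (induction q rule: kspace_induct)
      case (basis v)
      show ?case by (simp add: \<open>\<And>u. ?H (basis_elem u) = tree_eval tri g u\<close> tree_eval_graft)
    qed (simp_all add: right tri_linear_simps H.add H.scale)
  qed (simp_all add: left tri_linear_simps H.add H.scale)
qed

text \<open>The kernel of the evaluation is a two-sided ideal by multiplicativity and contains the
  relators by the identities of the target; \<open>J\<close> is the least such ideal.\<close>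

lemma lin_map_tree_eval_J:
  fixes scale :: "'k::field \<Rightarrow> 'm::ab_group_add \<Rightarrow> 'm"
  assumes "nc_multi_novikov scale tri" "p \<in> J"
  shows "lin_map scale (tree_eval tri g) p = 0"
proof -
  interpret nc_multi_novikov scale tri by (rule assms(1))
  let ?H = "lin_map scale (tree_eval tri g)"
  interpret H: Vector_Spaces.linear kscale scale ?H
    by (rule linear_lin_map) (rule vector_space_axioms)
  note tri = lin_map_tree_tri[OF assms(1)]
  have "novikov_relators \<subseteq> {p. ?H p = 0}"
    unfolding novikov_relators_def
  proof (safe)
    fix w t x y z
    show "?H (tree_tri t (tree_tri w x y) z - tree_tri w x (tree_tri t y z)
        - tree_tri t (tree_tri w y x) z + tree_tri w y (tree_tri t x z)) = 0"
      using left_symmetric[of t w "?H x" "?H y" "?H z"]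
      by (simp add: H.add H.diff tri)
    show "?H (tree_tri t (tree_tri w x y) z - tree_tri w (tree_tri t x z) y) = 0"
      using right_commutative[of t w "?H x" "?H y" "?H z"] by (simp add: H.diff tri)
  qed
  moreover have "two_sided_ideal kscale tree_tri {p. ?H p = 0}"
    unfolding two_sided_ideal_def
    by (auto intro!: kspace.subspaceI simp: H.add H.scale H.zero tri tri_linear_simps)
  ultimately have "J \<subseteq> {p. ?H p = 0}"
    unfolding J_def by (rule hull_minimal)
  with assms(2) show ?thesis by blast
qed

lemma nov_free:
  "free_nc_multi_novikov (target :: 'm::ab_group_add itself) nov_scale
     (nov_tri :: 'o \<Rightarrow> ('x, 'o, 'k::field) nov \<Rightarrow> _) (\<lambda>x. coset (basis_elem (vertex x)))"
  unfolding free_nc_multi_novikov_def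
proof (intro conjI allI impI nov_nc_multi_novikov)
  fix scale :: "'k \<Rightarrow> 'm \<Rightarrow> 'm" and tri :: "'o \<Rightarrow> 'm \<Rightarrow> 'm \<Rightarrow> 'm" and g :: "'x \<Rightarrow> 'm"
  assume nov: "nc_multi_novikov scale tri"
  then interpret nc_multi_novikov scale tri .
  let ?H = "lin_map scale (tree_eval tri g)"
  interpret H: Vector_Spaces.linear kscale scale ?H
    by (rule linear_lin_map) (rule vector_space_axioms)
  \<comment> \<open>The value does not depend on the representative chosen by
    \<open>inv coset\<close>, since the evaluation vanishes on \<open>J\<close>.\<close>
  define h where "h c = ?H (inv coset c)" for c :: "('x, 'o, 'k) nov"
  have h: "h (coset p) = ?H p" for p
  proof -
    have "inv coset (coset p) - p \<in> J"
      unfolding coset_eq_iff[symmetric] by (simp add: f_inv_into_f)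
    from lin_map_tree_eval_J[OF nov this, of g] show ?thesis
      by (simp add: h_def H.diff)
  qed
  have cos: "\<exists>p. c = coset p" for c :: "('x, 'o, 'k) nov"
    using surj_coset by (metis surjD)
  have "h (c + d) = h c + h d" "h (nov_scale k c) = scale k (h c)"
    "h (nov_tri w c d) = tri w (h c) (h d)" for c d k w
  proof -
    obtain p q where "c = coset p" "d = coset q" using cos by metis
    then show "h (c + d) = h c + h d" "h (nov_scale k c) = scale k (h c)"
      "h (nov_tri w c d) = tri w (h c) (h d)"
      by (simp_all add: h H.add H.scale lin_map_tree_tri[OF nov] flip: coset_simps)
  qed
  then have hom: "nmn_hom nov_scale nov_tri scale tri h"
    by (simp add: nmn_hom_def Vector_Spaces.linear_iff vector_space_nov vector_space_axioms)
  show "\<exists>!h. nmn_hom nov_scale nov_tri scale tri h \<and> (\<forall>x. h (coset (basis_elem (vertex x))) = g x)"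
  proof (rule ex1I)
    show "nmn_hom nov_scale nov_tri scale tri h \<and> (\<forall>x. h (coset (basis_elem (vertex x))) = g x)"
      using hom by (simp add: h lin_map_def)
    fix h' assume h': "nmn_hom nov_scale nov_tri scale tri h' \<and> (\<forall>x. h' (coset (basis_elem (vertex x))) = g x)"
    show "h' = h"
    proof
      fix c :: "('x, 'o, 'k) nov"
      obtain p where "c = coset p" using cos by metis
      then show "h' c = h c"
        using h' by (simp add: h nmn_hom_coset)
    qed
  qed
qed

text \<open>Evaluating a tree in the quotient algebra itself gives its coset, so the spanning result
  for evaluations applies.\<close>

lemma span_coset_MNE:
  "module.span nov_scale ((\<lambda>u. coset (basis_elem u)) ` MNE) =
     (UNIV :: ('x::linorder, 'o::linorder, 'k::field) nov set)"
proof -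
  interpret nov: nc_multi_novikov nov_scale "nov_tri :: 'o \<Rightarrow> ('x, 'o, 'k) nov \<Rightarrow> _"
    by (rule nov_nc_multi_novikov)
  let ?\<nu> = "\<lambda>u. coset (basis_elem u) :: ('x, 'o, 'k) nov"
  have \<nu>: "?\<nu> ` MNE = tree_eval nov_tri (\<lambda>x. coset (basis_elem (vertex x))) ` MNE"
    by (rule image_cong[OF refl coset_basis_elem])
  have \<nu>_span: "?\<nu> u \<in> nov.span (?\<nu> ` MNE)" for u
    unfolding \<nu> coset_basis_elem[of u] by (rule tree_eval_in_span_MNE[OF nov_nc_multi_novikov])
  have "coset p \<in> nov.span (?\<nu> ` MNE)" for p
    by (induction p rule: kspace_induct) (simp_all add: \<nu>_span coset_simps nov.span_add nov.span_scale)
  then show ?thesis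
    using surj_coset by (metis UNIV_eq_I surjD)
qed

section \<open>The algebra of differential polynomials generated by the variables\<close>

lemma vector_space_pcd: "vector_space (pcd_scale :: 'k::field \<Rightarrow> ('x, 'o, 'k) pcd \<Rightarrow> _)"
proof
  fix a b :: "('x, 'o, 'k) pcd" and k l :: 'k
  show "pcd_scale k (a + b) = pcd_scale k a + pcd_scale k b"
    by transfer (rule kspace.scale_right_distrib)
  show "pcd_scale (k + l) a = pcd_scale k a + pcd_scale l a"
    by transfer (rule kspace.scale_left_distrib)
  show "pcd_scale k (pcd_scale l a) = pcd_scale (k * l) a"
    by transfer simp
  show "pcd_scale 1 a = a"
    by transfer simp
qed

lemma pcd_nc_multi_novikov: "nc_multi_novikov pcd_scale (pcd_tri :: 'o \<Rightarrow> ('x, 'o, 'k::field) pcd \<Rightarrow> _)"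
proof -
  interpret P: nc_multi_novikov kscale "dpoly_tri :: 'o \<Rightarrow> ('x, 'o, 'k) dpoly \<Rightarrow> _"
    by (rule dpoly_nc_multi_novikov)
  interpret vector_space "pcd_scale :: 'k \<Rightarrow> ('x, 'o, 'k) pcd \<Rightarrow> _" by (rule vector_space_pcd)
  show ?thesis
  proof unfold_locales
    fix w t :: 'o and a b c :: "('x, 'o, 'k) pcd" and k :: 'k
    show "pcd_tri w a (b + c) = pcd_tri w a b + pcd_tri w a c"
      "pcd_tri w (a + b) c = pcd_tri w a c + pcd_tri w b c"
      "pcd_tri w a (pcd_scale k b) = pcd_scale k (pcd_tri w a b)"
      "pcd_tri w (pcd_scale k a) b = pcd_scale k (pcd_tri w a b)"
      by (transfer, simp add: P.tri_linear_simps)+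
    show "pcd_tri t (pcd_tri w a b) c - pcd_tri w a (pcd_tri t b c) =
        pcd_tri t (pcd_tri w b a) c - pcd_tri w b (pcd_tri t a c)"
      by transfer (rule P.left_symmetric)
    show "pcd_tri t (pcd_tri w a b) c = pcd_tri w (pcd_tri t a c) b"
      by transfer (rule P.right_commutative)
  qed
qed

lemma nmn_hom_Rep_pcd:
  "nmn_hom pcd_scale pcd_tri kscale dpoly_tri (Rep_pcd :: ('x, 'o, 'k::field) pcd \<Rightarrow> _)"
  by (simp add: nmn_hom_def Vector_Spaces.linear_iff vector_space_pcd vector_space_kscale
      plus_pcd.rep_eq pcd_scale.rep_eq pcd_tri.rep_eq)

lemma nmn_hom_comp:
  "nmn_hom scale1 tri1 scale2 tri2 f \<Longrightarrow> nmn_hom scale2 tri2 scale3 tri3 h \<Longrightarrow>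
     nmn_hom scale1 tri1 scale3 tri3 (\<lambda>x. h (f x))"
  by (simp add: nmn_hom_def Vector_Spaces.linear_iff)

text \<open>Followed by the inclusion into all polynomials, such a homomorphism becomes explicit: it
  evaluates trees as differential polynomials.\<close>

lemma Rep_pcd_hom_coset:
  assumes "nmn_hom nov_scale nov_tri pcd_scale pcd_tri f"
    and "\<And>x. f (coset (basis_elem (vertex x))) = pcd_var x"
  shows "Rep_pcd (f (coset p)) = lin_ext (tree_eval dpoly_tri (dvar [])) p"
  using nmn_hom_coset[OF nmn_hom_comp[OF assms(1) nmn_hom_Rep_pcd], of "dvar []" p]
  by (simp add: assms(2) pcd_var.rep_eq lin_map_kscale)

text \<open>Evaluation in differential polynomials kills \<open>J\<close> but separates the elements
  of \<open>kMNE\<close>.\<close>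

lemma inj_on_coset_kMNE:
  "inj_on coset (kMNE :: (('x::linorder, 'o::linorder) mtree \<Rightarrow>\<^sub>0 'k::field) set)"
proof (rule inj_onI)
  fix p q :: "('x, 'o) mtree \<Rightarrow>\<^sub>0 'k"
  assume "p \<in> kMNE" "q \<in> kMNE" and eq: "coset p = coset q"
  then have "p - q \<in> kMNE"
    unfolding kMNE_def by (simp add: kspace.span_diff)
  then have "Poly_Mapping.keys (p - q) \<subseteq> MNE"
    unfolding kMNE_def by (rule keys_span_basis_elem)
  moreover have "p - q \<in> J" using eq by (simp add: coset_eq_iff)
  then have "lin_ext (tree_eval dpoly_tri (dvar [])) (p - q) = (0 :: ('x, 'o, 'k) dpoly)"
    using lin_map_tree_eval_J[OF dpoly_nc_multi_novikov] by (metis lin_map_kscale)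
  ultimately show "p = q"
    using MNE_independent_dpoly[of "p - q"] by simp
qed

lemma coset_kMNE: "coset ` kMNE = (UNIV :: ('x::linorder, 'o::linorder, 'k::field) nov set)"
proof -
  interpret Vector_Spaces.linear kscale nov_scale "coset :: _ \<Rightarrow> ('x, 'o, 'k) nov" by (rule linear_coset)
  show ?thesis
    using span_image[of "basis_elem ` MNE"] by (simp add: kMNE_def image_image span_coset_MNE)
qed

lemma nov_pcd_iso:
  fixes f :: "('x::linorder, 'o::linorder, 'k::field) nov \<Rightarrow> ('x, 'o, 'k) pcd"
  assumes hom: "nmn_hom nov_scale nov_tri pcd_scale pcd_tri f"
    and var: "\<And>x. f (coset (basis_elem (vertex x))) = pcd_var x"
  shows "nmn_iso nov_scale nov_tri pcd_scale pcd_tri f"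
proof -
  note Rep = Rep_pcd_hom_coset[OF hom var]
  have add: "f (x + y) = f x + f y" and scale: "f (nov_scale c x) = pcd_scale c (f x)"
    and tri: "f (nov_tri w x y) = pcd_tri w (f x) (f y)" for c w x y
    using hom by (simp_all add: nmn_hom_def Vector_Spaces.linear_iff)
  have "inj f"
  proof (rule injI)
    fix c d assume eq: "f c = f d"
    \<comment> \<open>Spanning provides representatives in \<open>kMNE\<close>, where the evaluation
      is injective.\<close>
    obtain p q where pq: "c = coset p" "p \<in> kMNE" "d = coset q" "q \<in> kMNE"
      using coset_kMNE by (metis UNIV_I imageE)
    then have "p - q \<in> kMNE"
      unfolding kMNE_def by (simp add: kspace.span_diff)
    then have keys: "Poly_Mapping.keys (p - q) \<subseteq> MNE"
      unfolding kMNE_def by (rule keys_span_basis_elem)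
    have "lin_ext (tree_eval dpoly_tri (dvar [])) p =
        (lin_ext (tree_eval dpoly_tri (dvar [])) q :: ('x, 'o, 'k) dpoly)"
      using eq Rep pq by metis
    then have "lin_ext (tree_eval dpoly_tri (dvar [])) (p - q) = (0 :: ('x, 'o, 'k) dpoly)"
      using lin_ext_add[of "tree_eval dpoly_tri (dvar []) :: _ \<Rightarrow> ('x, 'o, 'k) dpoly" "p - q" q] by simp
    with keys have "p - q = 0"
      by (rule MNE_independent_dpoly)
    with pq show "c = d" by simp
  qed
  moreover have "surj f"
  proof -
    \<comment> \<open>The image of \<open>f\<close>, viewed among all polynomials, is a subalgebra
      containing the variables \<open>dvar [] x\<close>; \<open>PCD_set\<close> is the least
      one.\<close>
    let ?S = "range (\<lambda>c. Rep_pcd (f c))"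
    have "PCD_set \<subseteq> ?S"
      unfolding PCD_set_def
    proof (rule hull_minimal)
      show "range (dvar []) \<subseteq> ?S"
        using var pcd_var.rep_eq by (metis image_subsetI rangeI)
      have "Rep_pcd (f x) + Rep_pcd (f y) \<in> ?S" "kscale c (Rep_pcd (f x)) \<in> ?S"
        "dpoly_tri w (Rep_pcd (f x)) (Rep_pcd (f y)) \<in> ?S" for x y c w
        by (simp_all flip: plus_pcd.rep_eq pcd_scale.rep_eq pcd_tri.rep_eq add scale tri)
      moreover have "0 \<in> ?S"
      proof -
        have "f 0 = 0" using add[of 0 0] by simp
        then show ?thesis by (metis rangeI zero_pcd.rep_eq)
      qed
      ultimately show "subalgebra kscale dpoly_tri ?S"
        unfolding subalgebra_def by (intro conjI kspace.subspaceI) auto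
    qed
    then have "\<exists>c. Rep_pcd y = Rep_pcd (f c)" for y
      using Rep_pcd[of y] by blast
    then show ?thesis
      by (metis Rep_pcd_inject surjI surj_def)
  qed
  ultimately show ?thesis
    using hom by (simp add: nmn_iso_def bij_def)
qed

text \<open>Composition with \<open>f\<close> and with its inverse matches the homomorphisms out of
  the two algebras.\<close>

lemma free_nc_multi_novikov_iso:
  fixes target :: "'m::ab_group_add itself" and scale1 :: "'k::field \<Rightarrow> 'a::ab_group_add \<Rightarrow> 'a"
    and tri1 :: "'o \<Rightarrow> 'a \<Rightarrow> 'a \<Rightarrow> 'a" and i :: "'x \<Rightarrow> 'a"
  assumes free: "free_nc_multi_novikov target scale1 tri1 i"
    and iso: "nmn_iso scale1 tri1 scale2 tri2 f"
    and nov: "nc_multi_novikov scale2 tri2"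
    and j: "\<And>x. j x = f (i x)"
  shows "free_nc_multi_novikov target scale2 tri2 j"
  unfolding free_nc_multi_novikov_def
proof (intro conjI allI impI nov)
  fix scale :: "'k \<Rightarrow> 'm \<Rightarrow> 'm" and tri :: "'o \<Rightarrow> 'm \<Rightarrow> 'm \<Rightarrow> 'm" and g :: "'x \<Rightarrow> 'm"
  assume "nc_multi_novikov scale tri"
  with free have ex1: "\<exists>!h. nmn_hom scale1 tri1 scale tri h \<and> (\<forall>x. h (i x) = g x)"
    unfolding free_nc_multi_novikov_def by blast
  from iso have hom: "nmn_hom scale1 tri1 scale2 tri2 f" and bij: "bij f"
    by (auto simp: nmn_iso_def)
  have inv: "f (inv f y) = y" "inv f (f x) = x" for x y
    using bij by (simp_all add: bij_def surj_f_inv_f inv_f_f)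
  have inv_eqI: "f x = y \<Longrightarrow> inv f y = x" for x y
    using inv(2) by blast
  have inv_hom: "nmn_hom scale2 tri2 scale1 tri1 (inv f)"
  proof -
    have "inv f (x + y) = inv f x + inv f y" for x y
      by (rule inv_eqI) (use hom in \<open>simp add: nmn_hom_def Vector_Spaces.linear_iff inv\<close>)
    moreover have "inv f (scale2 c x) = scale1 c (inv f x)" for c x
      by (rule inv_eqI) (use hom in \<open>simp add: nmn_hom_def Vector_Spaces.linear_iff inv\<close>)
    moreover have "inv f (tri2 w x y) = tri1 w (inv f x) (inv f y)" for w x y
      by (rule inv_eqI) (use hom in \<open>simp add: nmn_hom_def inv\<close>)
    ultimately show ?thesis
      using hom by (simp add: nmn_hom_def Vector_Spaces.linear_iff)
  qed
  from ex1 obtain h where h: "nmn_hom scale1 tri1 scale tri h" "\<And>x. h (i x) = g x"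
    by blast
  show "\<exists>!h. nmn_hom scale2 tri2 scale tri h \<and> (\<forall>x. h (j x) = g x)"
  proof (rule ex1I)
    show "nmn_hom scale2 tri2 scale tri (\<lambda>y. h (inv f y)) \<and> (\<forall>x. h (inv f (j x)) = g x)"
      using nmn_hom_comp[OF inv_hom h(1)] h(2) by (simp add: j inv)
    fix h' assume h': "nmn_hom scale2 tri2 scale tri h' \<and> (\<forall>x. h' (j x) = g x)"
    then have "nmn_hom scale1 tri1 scale tri (\<lambda>x. h' (f x)) \<and> (\<forall>x. h' (f (i x)) = g x)"
      by (simp add: j nmn_hom_comp[OF hom])
    with ex1 h have "(\<lambda>x. h' (f x)) = h" by blast
    then show "h' = (\<lambda>y. h (inv f y))"
      by (auto simp: inv)
  qed
qed

theorem theorem4p8: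
  fixes target :: "'m::ab_group_add itself"
    and \<eta> :: "(('x::linorder, 'o::linorder) mtree \<Rightarrow>\<^sub>0 'k::field) \<Rightarrow> ('x, 'o, 'k) nov"
    and \<nu> :: "('x, 'o) mtree \<Rightarrow> ('x, 'o, 'k) nov"
  defines "\<eta> \<equiv> coset"
    and "\<nu> \<equiv> (\<lambda>u. coset (basis_elem u))"
  shows
    "(Vector_Spaces.linear kscale nov_scale \<eta> \<and> bij_betw \<eta> kMNE UNIV) \<and>
     (free_nc_multi_novikov target nov_scale nov_tri (\<lambda>x. \<nu> (vertex x)) \<and>
        inj_on \<nu> MNE \<and>
        \<not> module.dependent nov_scale (\<nu> ` MNE) \<and>
        module.span nov_scale (\<nu> ` MNE) = UNIV) \<and>
     (\<exists>!f :: ('x, 'o, 'k) nov \<Rightarrow> ('x, 'o, 'k) pcd.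
        nmn_hom nov_scale nov_tri pcd_scale pcd_tri f \<and> (\<forall>x. f (\<nu> (vertex x)) = pcd_var x)) \<and>
     (\<forall>f :: ('x, 'o, 'k) nov \<Rightarrow> ('x, 'o, 'k) pcd.
        nmn_hom nov_scale nov_tri pcd_scale pcd_tri f \<and> (\<forall>x. f (\<nu> (vertex x)) = pcd_var x) \<longrightarrow>
        nmn_iso nov_scale nov_tri pcd_scale pcd_tri f) \<and>
     free_nc_multi_novikov target
       (pcd_scale :: 'k \<Rightarrow> ('x, 'o, 'k) pcd \<Rightarrow> ('x, 'o, 'k) pcd) pcd_tri pcd_var"
proof -
  interpret coset: Vector_Spaces.linear kscale nov_scale "coset :: _ \<Rightarrow> ('x, 'o, 'k) nov"
    by (rule linear_coset)
  have inj: "inj_on \<nu> MNE"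
  proof (rule inj_onI)
    fix u v :: "('x, 'o) mtree"
    assume uv: "u \<in> MNE" "v \<in> MNE" "\<nu> u = \<nu> v"
    then have "(basis_elem u :: _ \<Rightarrow>\<^sub>0 'k) = basis_elem v"
      using inj_on_coset_kMNE
      by (auto simp: \<nu>_def kMNE_def kspace.span_base dest: inj_onD)
    then show "u = v"
      by (metis keys_single singleton_inject zero_neq_one)
  qed
  \<comment> \<open>\<open>coset\<close> is injective on the span of the independent basis elements,
    so their images stay independent.\<close>
  have indep: "\<not> module.dependent nov_scale (\<nu> ` MNE)"
    using coset.independent_injective_image[OF independent_basis_elem, of MNE]
      inj_on_coset_kMNE[unfolded kMNE_def]
    by (simp add: \<nu>_def image_image)
  \<comment> \<open>Freeness of the quotient with \<open>pcd\<close> as the target algebra; below it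
    is used again with target type \<open>'m\<close>.\<close>
  have ex1: "\<exists>!f :: ('x, 'o, 'k) nov \<Rightarrow> ('x, 'o, 'k) pcd.
      nmn_hom nov_scale nov_tri pcd_scale pcd_tri f \<and> (\<forall>x. f (\<nu> (vertex x)) = pcd_var x)"
    unfolding \<nu>_def
    using nov_free[unfolded free_nc_multi_novikov_def, THEN conjunct2, rule_format, OF pcd_nc_multi_novikov] .
  then obtain f :: "('x, 'o, 'k) nov \<Rightarrow> ('x, 'o, 'k) pcd" where
    f: "nmn_hom nov_scale nov_tri pcd_scale pcd_tri f" "\<And>x. f (\<nu> (vertex x)) = pcd_var x"
    by blast
  have iso: "nmn_iso nov_scale nov_tri pcd_scale pcd_tri f"
    if "nmn_hom nov_scale nov_tri pcd_scale pcd_tri f \<and> (\<forall>x. f (\<nu> (vertex x)) = pcd_var x)"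
    for f :: "('x, 'o, 'k) nov \<Rightarrow> ('x, 'o, 'k) pcd"
    using that by (intro nov_pcd_iso) (simp_all add: \<nu>_def)
  have free: "free_nc_multi_novikov target nov_scale nov_tri (\<lambda>x. \<nu> (vertex x))"
    unfolding \<nu>_def by (rule nov_free)
  have "free_nc_multi_novikov target
       (pcd_scale :: 'k \<Rightarrow> ('x, 'o, 'k) pcd \<Rightarrow> ('x, 'o, 'k) pcd) pcd_tri pcd_var"
    by (rule free_nc_multi_novikov_iso[OF free iso pcd_nc_multi_novikov]) (use f in auto)
  moreover have "bij_betw \<eta> kMNE UNIV"
    unfolding \<eta>_def bij_betw_def using inj_on_coset_kMNE coset_kMNE by blast
  moreover have "module.span nov_scale (\<nu> ` MNE) = UNIV"
    unfolding \<nu>_def by (rule span_coset_MNE)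
  ultimately show ?thesis
    unfolding \<eta>_def using linear_coset free inj indep ex1 iso by (intro conjI allI impI)
qed

end
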